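(* Let $d\ge2$ and let $D\subset\mathbb{R}^d$ be a $\operatorname{CAT}(0)$ domain, bounded in the Euclidean metric, satisfying a uniform exterior sphere condition based on radius $r>0$ and a uniform interior cone condition based on radius $\delta>0$ and angle $\alpha\in(0,\pi/2]$. For every $c_1>0$ there exist $c_2,c_3\in(0,\infty)$ such that, if $x,y,u\in\overline D$ with $u\ne x$, $\operatorname{dist}_{\mathrm{intr}}(x,y)\ge c_1$ and $\max\{\sqrt{|u-x|},|u-x|\}\le c_2$, then $$\big|\operatorname{dist}_{\mathrm{intr}}(u,y)-\big(\operatorname{dist}_{\mathrm{intr}}(x,y)+|u-x|\cos\theta\big)\big|\le c_3|u-x|^{3/2},$$ where $\theta$ is the exterior angle at $x$ between the geodesic from $y$ to $x$ and the Euclidean segment from $x$ to $u$, i.e. the angle between the vectors $-\chi(x,y)$ and $u-x$. Consequently, if $x,y\in\overline D$ with $x\neq y$, then $$\operatorname{grad}_x\operatorname{dist}_{\mathrm{intr}}(x,y)=-\chi(x,y).$$ Moreover, for such $x,y$, the gradient in both variables is $$\operatorname{grad}\operatorname{dist}_{\mathrm{intr}}(x,y)=(-\chi(x,y),-\chi(y,x)).$$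
   Context: A domain is a connected open subset of $\mathbb{R}^d$. $\mathcal{B}(y,s)$ is the open Euclidean ball of radius $s$ centred at $y$. Uniform exterior sphere condition (based on radius $r>0$): for $x\in\partial D$ let $\mathcal{N}_{x,r}=\{\nu\in\mathbb{R}^d: |\nu|=1,\ \mathcal{B}(x+r\nu,r)\cap D=\varnothing\}$. The condition requires that for every $x\in\partial D$, $\mathcal{N}_{x,r}\neq\varnothing$ and $\mathcal{N}_{x,r}=\mathcal{N}_{x,s}$ for all $0<s\le r$. Uniform interior cone condition (based on radius $\delta>0$ and angle $\alpha\in(0,\pi/2]$): for every $x\in\partial D$ there is a unit vector $\mathbf m$ such that the cone $C(\mathbf m)=\{z:\langle z,\mathbf m\rangle>|z|\cos\alpha\}$ satisfies $(y+C(\mathbf m))\cap\mathcal{B}(x,\delta)\subseteq D$ for all $y\in D\cap\mathcal{B}(x,\delta)$. Intrinsic metric: $\operatorname{dist}_{\mathrm{intr}}(x,y)$ is the infimum of the lengths of smooth paths in $D$ connecting $x$ and $y$. Under the uniform interior cone condition, the completion of $D$ in this metric is identified with the Euclidean closure $\overline D$, to which $\operatorname{dist}_{\mathrm{intr}}$ extends by continuity. Intrinsic geodesics are paths in $\overline D$ attaining the infimum. $\operatorname{CAT}(0)$: $(D,\operatorname{dist}_{\mathrm{intr}})$ is $\operatorname{CAT}(0)$ if, whenever $\Gamma_{a,b},\Gamma_{a,c},\Gamma_{b,c}$ are unit-speed intrinsic geodesics connecting $a$ to $b$, $a$ to $c$, $b$ to $c$, one has $\operatorname{dist}_{\mathrm{intr}}(\Gamma_{a,b}(s),\Gamma_{a,c}(t))\le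 r(s,t)$, where $r(s,t)$ is the distance between the points at distance $s$, respectively $t$, from $\tilde a$ along the sides $\tilde a\tilde b$, respectively $\tilde a\tilde c$, of a Euclidean triangle $\tilde a\tilde b\tilde c$ with the same side lengths. The closure $\overline D$ inherits this property. For distinct $x,y\in\overline D$, $\chi(x,y)$ is the unit vector that is the initial velocity at $x$ of the unique unit-speed intrinsic geodesic from $x$ to $y$ (such geodesics are continuously differentiable under the present hypotheses). $\operatorname{grad}_x$ is the Euclidean gradient with respect to $x$, and $\operatorname{grad}$ is the gradient with respect to both variables; at points of the boundary these are understood relative to $\overline D$, i.e. as first-order expansions $\operatorname{dist}_{\mathrm{intr}}(u,y)=\operatorname{dist}_{\mathrm{intr}}(x,y)+\langle \operatorname{grad}_x\operatorname{dist}_{\mathrm{intr}}(x,y),u-x\rangle+o(|u-x|)$ for $u\in\overline D$, $u\to x$ (and similarly for the pair of variables in $\overline D\times\overline D$). *)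

theory Defs
  imports "HOL-Analysis.Analysis"
begin

definition ext_normals :: "'a::euclidean_space set \<Rightarrow> 'a \<Rightarrow> real \<Rightarrow> 'a set" where
  "ext_normals D x r = {\<nu>. norm \<nu> = 1 \<and> ball (x + r *\<^sub>R \<nu>) r \<inter> D = {}}"

definition uniform_exterior_sphere :: "real \<Rightarrow> 'a::euclidean_space set \<Rightarrow> bool" where
  "uniform_exterior_sphere r D \<longleftrightarrow>
     (\<forall>x\<in>frontier D. ext_normals D x r \<noteq> {} \<and>
        (\<forall>s. 0 < s \<and> s \<le> r \<longrightarrow> ext_normals D x r = ext_normals D x s))"

definition open_cone :: "real \<Rightarrow> 'a::euclidean_space \<Rightarrow> 'a set" where
  "open_cone \<alpha> m = {z. z \<bullet> m > norm z * cos \<alpha>}"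

definition uniform_interior_cone :: "real \<Rightarrow> real \<Rightarrow> 'a::euclidean_space set \<Rightarrow> bool" where
  "uniform_interior_cone \<delta> \<alpha> D \<longleftrightarrow>
     (\<forall>x\<in>frontier D. \<exists>m. norm m = 1 \<and>
        (\<forall>y\<in>D \<inter> ball x \<delta>. (+) y ` open_cone \<alpha> m \<inter> ball x \<delta> \<subseteq> D))"

text \<open>Length of \<open>g\<close> restricted to \<open>{a..b}\<close>: supremum over inscribed polygons, possibly infinite.\<close>

definition curve_length :: "real \<Rightarrow> real \<Rightarrow> (real \<Rightarrow> 'a::metric_space) \<Rightarrow> ennreal" where
  "curve_length a b g =
     (SUP ts \<in> {ts. sorted ts \<and> set ts \<subseteq> {a..b}}.
        ennreal (\<Sum>i<length ts - 1. dist (g (ts ! i)) (g (ts ! Suc i))))"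

text \<open>\<open>C\<^sup>\<infinity>\<close> on \<open>{0..1}\<close> with one-sided derivatives at the endpoints; \<open>f n\<close> is the \<open>n\<close>-th derivative.\<close>

definition smooth_path :: "(real \<Rightarrow> 'a::real_normed_vector) \<Rightarrow> bool" where
  "smooth_path g \<longleftrightarrow>
     (\<exists>f. f 0 = g \<and>
        (\<forall>n. \<forall>t\<in>{0..1}. (f n has_vector_derivative f (Suc n) t) (at t within {0..1})))"

text \<open>The intrinsic metric on \<open>D\<close> itself. The infimum is finite when \<open>D\<close> is open and connected;
  \<^const>\<open>enn2real\<close> would map an infimum over the empty set to 0.\<close>

definition intr_dist_on :: "'a::euclidean_space set \<Rightarrow> 'a \<Rightarrow> 'a \<Rightarrow> real" where
  "intr_dist_on D x y =
     enn2real (INF g \<in> {g. smooth_path g \<and> path_image g \<subseteq> D \<and> pathstart g = x \<and> pathfinish g = y}.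
                 curve_length 0 1 g)"

text \<open>Its extension by continuity to the Euclidean closure.\<close>

definition intr_dist :: "'a::euclidean_space set \<Rightarrow> 'a \<Rightarrow> 'a \<Rightarrow> real" where
  "intr_dist D x y =
     (if x \<in> D \<and> y \<in> D then intr_dist_on D x y
      else Lim (at (x, y) within D \<times> D) (\<lambda>(u, v). intr_dist_on D u v))"

text \<open>Paths in \<open>closure D\<close> from \<open>x\<close> to \<open>y\<close>, parametrised by arc length, whose length is the
  intrinsic distance. Only the values of \<open>\<gamma>\<close> on \<open>{0..intr_dist D x y}\<close> matter.\<close>

definition unit_speed_geodesic ::
    "'a::euclidean_space set \<Rightarrow> 'a \<Rightarrow> 'a \<Rightarrow> (real \<Rightarrow> 'a) \<Rightarrow> bool" where
  "unit_speed_geodesic D x y \<gamma> \<longleftrightarrow>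
     \<gamma> 0 = x \<and> \<gamma> (intr_dist D x y) = y \<and> \<gamma> ` {0..intr_dist D x y} \<subseteq> closure D \<and>
     (\<forall>s t. 0 \<le> s \<and> s \<le> t \<and> t \<le> intr_dist D x y \<longrightarrow> curve_length s t \<gamma> = ennreal (t - s))"

text \<open>The point at distance \<open>s\<close> from \<open>p\<close> along the segment from \<open>p\<close> to \<open>q\<close>
  (equal to \<open>p\<close> if \<open>p = q\<close>).\<close>

definition along_segment :: "'a::real_normed_vector \<Rightarrow> 'a \<Rightarrow> real \<Rightarrow> 'a" where
  "along_segment p q s = p + (s / dist p q) *\<^sub>R (q - p)"

text \<open>Comparison triangles live in the Euclidean plane; they are unique up to isometry.\<close>

definition cat0 :: "'a::euclidean_space set \<Rightarrow> bool" where
  "cat0 D \<longleftrightarrow>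
     (\<forall>a\<in>D. \<forall>b\<in>D. \<forall>c\<in>D. \<forall>\<Gamma>ab \<Gamma>ac \<Gamma>bc.
        unit_speed_geodesic D a b \<Gamma>ab \<and> unit_speed_geodesic D a c \<Gamma>ac \<and>
        unit_speed_geodesic D b c \<Gamma>bc \<longrightarrow>
        (\<forall>a' b' c' :: real ^ 2.
           dist a' b' = intr_dist D a b \<and> dist a' c' = intr_dist D a c \<and>
           dist b' c' = intr_dist D b c \<longrightarrow>
           (\<forall>s\<in>{0..intr_dist D a b}. \<forall>t\<in>{0..intr_dist D a c}.
              intr_dist D (\<Gamma>ab s) (\<Gamma>ac t) \<le>
              dist (along_segment a' b' s) (along_segment a' c' t))))"

text \<open>Initial velocity of the geodesic from \<open>x\<close> to \<open>y\<close>, usually written \<open>\<chi>(x, y)\<close>, a symbol taken by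
  the vector binder. A description of the velocity rather than of the geodesic, which is
  determined only on \<open>{0..intr_dist D x y}\<close>.\<close>

definition init_dir :: "'a::euclidean_space set \<Rightarrow> 'a \<Rightarrow> 'a \<Rightarrow> 'a" where
  "init_dir D x y =
     (THE v. norm v = 1 \<and>
        (\<exists>\<gamma>. unit_speed_geodesic D x y \<gamma> \<and>
             (\<gamma> has_vector_derivative v) (at 0 within {0..intr_dist D x y})))"

definition vec_angle :: "'a::real_inner \<Rightarrow> 'a \<Rightarrow> real" where
  "vec_angle v w = arccos ((v \<bullet> w) / (norm v * norm w))"

text \<open>Gradient relative to a set \<open>S\<close>, i.e. a first-order expansion along \<open>S\<close>.\<close>

definition has_gradient_within :: "('a::real_inner \<Rightarrow> real) \<Rightarrow> 'a \<Rightarrow> 'a \<Rightarrow> 'a set \<Rightarrow> bool" where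
  "has_gradient_within f g x S \<longleftrightarrow> (f has_derivative (\<lambda>h. g \<bullet> h)) (at x within S)"

end

theory Submission
  imports Defs
begin

text \<open>Write \<open>d\<close> for the intrinsic distance on the closure \<open>K\<close> of \<open>D\<close>, let \<open>w = u - x\<close>, and let \<open>v\<close> be the initial
velocity of the geodesic from \<open>x\<close> to \<open>y\<close>. Three facts about \<open>d\<close> give the theorem.

Locally \<open>d\<close> is Euclidean up to a cubic error: \<open>d(p, q) \<le> |p - q| + \<kappa> |p - q|\<^sup>3\<close> for close \<open>p\<close> and \<open>q\<close>
(\<open>intr_dist_on_le_cubic\<close>). By the exterior sphere condition the point of \<open>K\<close> nearest to the midpoint of
\<open>p\<close> and \<open>q\<close> is so close to it that the detour through this point costs a cubic error only. Repeated
bisection produces fine chains in \<open>K\<close>, and the interior cone condition allows them to be pushed into \<open>D\<close>.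

Hence geodesics have initial velocities, with \<open>|\<gamma>(t) - x - t v| = O(t\<^sup>2)\<close> uniformly (\<open>geodesic_velocity\<close>):
a curve whose chords are shorter than its arcs by a cubic amount only nearly attains equality in the
triangle inequality, and the parallelogram law turns this into a linear bound for how much
its difference quotients vary.

Geodesics from \<open>x\<close> and \<open>u\<close> to the same point \<open>y\<close> stay within \<open>2 d(x, u)\<close> of each other
(\<open>geodesics_to_common_end\<close>). This is the convexity that the comparison property provides. It is used
in the form of Stewart's inequality, which bounds the distance from a point to a point of a geodesic by the
distances to the two ends. This form survives limits, so it passes from \<open>D\<close> to \<open>K\<close>, where it also
yields uniqueness of geodesics.

Now let \<open>s = |w|\<^sup>1\<^sup>/\<^sup>2\<close>. Going straight from \<open>u\<close> to \<open>\<gamma>(s)\<close> and then along the geodesic shows that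
\<open>d(u, y) \<le> d(x, y) - \<langle>w, v\<rangle> + O(|w|\<^sup>2 / s + s |w| + s\<^sup>3)\<close>, where the terms come from Pythagoras, from the
quadratic error of the velocity and from the cubic error of the metric; the choice of \<open>s\<close> makes each of them
\<open>|w|\<^sup>3\<^sup>/\<^sup>2\<close>. The reverse inequality is the same argument along the geodesic from \<open>u\<close> to \<open>y\<close>, whose
velocity may be replaced by \<open>v\<close> because the two geodesics stay close (\<open>first_variation\<close>).
For the gradient in both variables, \<open>x\<close> and \<open>y\<close> are moved one after the other; the velocity at \<open>x\<close>
is Lipschitz in the other end of the geodesic (\<open>direction_Lipschitz\<close>), so moving \<open>y\<close> first is harmless.\<close>

section \<open>Curves, their lengths and the intrinsic metric on an open set\<close>

text \<open>The derivative is again a combination, with nonnegative weights on the unit interval, of the increments of the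
coefficients. This is why bounds on increments survive the passage to Bernstein polynomials.\<close>

lemma Bernstein_sum_has_vector_derivative:
  fixes c :: "nat \<Rightarrow> 'a::real_normed_vector"
  shows "((\<lambda>x. \<Sum>k\<le>Suc n. Bernstein (Suc n) k x *\<^sub>R c k) has_vector_derivative
    (real (Suc n) *\<^sub>R (\<Sum>k\<le>n. Bernstein n k x *\<^sub>R (c (Suc k) - c k)))) (at x within S)"
proof -
  define A where "A k = (real (Suc n choose k) * (real k * x ^ (k - 1)) * (1 - x) ^ (Suc n - k)) *\<^sub>R c k" for k
  define B where "B k = (real (Suc n choose k) * x ^ k * (real (Suc n - k) * (1 - x) ^ (Suc n - k - 1))) *\<^sub>R c k" for k
  have D: "((\<lambda>x. \<Sum>k\<le>Suc n. Bernstein (Suc n) k x *\<^sub>R c k) has_vector_derivative (\<Sum>k\<le>Suc n. A k - B k)) (at x within S)"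
    unfolding Bernstein_def A_def B_def scaleR_diff_left[symmetric]
    by (intro has_vector_derivative_sum has_vector_derivative_scaleR[THEN has_vector_derivative_eq_rhs])
      (auto intro!: derivative_eq_intros simp: algebra_simps)
  have A0: "A 0 = 0" by (simp add: A_def)
  have B1: "B (Suc n) = 0" by (simp add: B_def)
  \<comment> \<open>the two halves of the product rule are regrouped according to the Bernstein polynomials of degree \<open>n\<close>\<close>
  have AS: "A (Suc k) = (real (Suc n) * Bernstein n k x) *\<^sub>R c (Suc k)" if "k \<le> n" for k
  proof -
    have "real (Suc k) * real (Suc n choose Suc k) = real (Suc n) * real (n choose k)"
      using Suc_times_binomial_eq[of n k] by (metis mult.commute of_nat_mult)
    then have "real (Suc n choose Suc k) * (real (Suc k) * x ^ k) * (1 - x) ^ (n - k) = real (Suc n) * Bernstein n k x"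
      by (simp add: Bernstein_def algebra_simps del: of_nat_Suc binomial_Suc_Suc)
    then show ?thesis by (simp add: A_def del: of_nat_Suc binomial_Suc_Suc)
  qed
  have BS: "B k = (real (Suc n) * Bernstein n k x) *\<^sub>R c k" if "k \<le> n" for k
  proof -
    have "(Suc n - k) * (Suc n choose k) = Suc n * (n choose k)"
      using binomial_absorb_comp[of "Suc n" k] by simp
    then have "real (Suc n - k) * real (Suc n choose k) = real (Suc n) * real (n choose k)"
      by (metis of_nat_mult)
    then have "real (Suc n choose k) * x ^ k * (real (Suc n - k) * (1 - x) ^ (n - k)) = real (Suc n) * Bernstein n k x"
      by (simp add: Bernstein_def algebra_simps del: of_nat_Suc binomial_Suc_Suc of_nat_diff)
    then show ?thesis using that by (simp add: B_def Suc_diff_le del: of_nat_Suc binomial_Suc_Suc)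
  qed
  have "(\<Sum>k\<le>Suc n. A k - B k) = (\<Sum>k\<le>Suc n. A k) - (\<Sum>k\<le>Suc n. B k)"
    by (simp only: sum_subtractf)
  also have "(\<Sum>k\<le>Suc n. A k) = (\<Sum>k\<le>n. A (Suc k))"
    unfolding sum.atMost_Suc_shift[of A n] A0 by simp
  also have "(\<Sum>k\<le>Suc n. B k) = (\<Sum>k\<le>n. B k)"
    by (simp add: B1)
  also have "(\<Sum>k\<le>n. A (Suc k)) - (\<Sum>k\<le>n. B k) = (\<Sum>k\<le>n. (real (Suc n) * Bernstein n k x) *\<^sub>R (c (Suc k) - c k))"
    unfolding sum_subtractf[symmetric] using AS BS
    by (intro sum.cong) (auto simp: scaleR_diff_right simp del: of_nat_Suc)
  also have "\<dots> = real (Suc n) *\<^sub>R (\<Sum>k\<le>n. Bernstein n k x *\<^sub>R (c (Suc k) - c k))"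
    by (simp add: scaleR_sum_right del: of_nat_Suc)
  finally show ?thesis using D by simp
qed

lemma Bernstein_endpoints:
  fixes c :: "nat \<Rightarrow> 'a::real_normed_vector"
  shows "(\<Sum>k\<le>n. Bernstein n k 0 *\<^sub>R c k) = c 0" "(\<Sum>k\<le>n. Bernstein n k 1 *\<^sub>R c k) = c n"
proof -
  have "(\<Sum>k\<le>n. Bernstein n k 0 *\<^sub>R c k) = (\<Sum>k\<in>{0}. Bernstein n k 0 *\<^sub>R c k)"
    by (rule sum.mono_neutral_right) (auto simp: Bernstein_def)
  then show "(\<Sum>k\<le>n. Bernstein n k 0 *\<^sub>R c k) = c 0" by (simp add: Bernstein_def)
  have "(\<Sum>k\<le>n. Bernstein n k 1 *\<^sub>R c k) = (\<Sum>k\<in>{n}. Bernstein n k 1 *\<^sub>R c k)"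
    by (rule sum.mono_neutral_right) (auto simp: Bernstein_def)
  then show "(\<Sum>k\<le>n. Bernstein n k 1 *\<^sub>R c k) = c n" by (simp add: Bernstein_def)
qed

text \<open>If \<open>\<phi>\<close> measures the length travelled along \<open>g\<close>, then the Bernstein polynomial of \<open>\<phi>\<close> does so for that of \<open>g\<close>,
because the derivatives can be compared term by term. So Bernstein polynomials do not lengthen curves.\<close>

lemma Bernstein_sum_increment_le:
  fixes g :: "nat \<Rightarrow> 'a::real_normed_vector" and \<phi> :: "nat \<Rightarrow> real"
  assumes "\<And>k. k < n \<Longrightarrow> norm (g (Suc k) - g k) \<le> \<phi> (Suc k) - \<phi> k"
    and "0 \<le> s" "s \<le> t" "t \<le> 1"
  shows "norm ((\<Sum>k\<le>n. Bernstein n k t *\<^sub>R g k) - (\<Sum>k\<le>n. Bernstein n k s *\<^sub>R g k))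
       \<le> (\<Sum>k\<le>n. Bernstein n k t * \<phi> k) - (\<Sum>k\<le>n. Bernstein n k s * \<phi> k)"
proof (cases "n = 0 \<or> s = t")
  case True
  then show ?thesis by (auto simp: Bernstein_def)
next
  case False
  then obtain m where n: "n = Suc m" and st: "s < t" using assms by (cases n) auto
  have g': "((\<lambda>x. \<Sum>k\<le>n. Bernstein n k x *\<^sub>R g k) has_vector_derivative
      (real (Suc m) *\<^sub>R (\<Sum>k\<le>m. Bernstein m k x *\<^sub>R (g (Suc k) - g k)))) (at x within S)" for x S
    unfolding n by (rule Bernstein_sum_has_vector_derivative)
  have \<phi>': "((\<lambda>x. \<Sum>k\<le>n. Bernstein n k x * \<phi> k) has_vector_derivative
      (real (Suc m) * (\<Sum>k\<le>m. Bernstein m k x * (\<phi> (Suc k) - \<phi> k)))) (at x within S)" for x S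
    using Bernstein_sum_has_vector_derivative[of m \<phi>] unfolding n by simp
  show ?thesis
  proof (rule differentiable_bound_general[OF st _ _ g' \<phi>'])
    show "continuous_on {s..t} (\<lambda>x. \<Sum>k\<le>n. Bernstein n k x *\<^sub>R g k)"
      "continuous_on {s..t} (\<lambda>x. \<Sum>k\<le>n. Bernstein n k x * \<phi> k)"
      by (rule continuous_on_vector_derivative, rule g') (rule continuous_on_vector_derivative, rule \<phi>')
    fix x assume x: "s < x" "x < t"
    have "norm (\<Sum>k\<le>m. Bernstein m k x *\<^sub>R (g (Suc k) - g k))
        \<le> (\<Sum>k\<le>m. Bernstein m k x * (\<phi> (Suc k) - \<phi> k))"
      using assms x
      by (intro sum_norm_le) (auto simp: n Bernstein_nonneg intro!: mult_left_mono)
    then show "norm (real (Suc m) *\<^sub>R (\<Sum>k\<le>m. Bernstein m k x *\<^sub>R (g (Suc k) - g k)))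
       \<le> real (Suc m) * (\<Sum>k\<le>m. Bernstein m k x * (\<phi> (Suc k) - \<phi> k))"
      by (simp del: of_nat_Suc)
  qed
qed

lemma Bernstein_Weierstrass_vector:
  fixes g :: "real \<Rightarrow> 'a::euclidean_space"
  assumes "continuous_on {0..1} g" "0 < e"
  shows "\<exists>n>0. \<forall>x\<in>{0..1}. norm (g x - (\<Sum>k\<le>n. Bernstein n k x *\<^sub>R g (real k / real n))) < e"
proof -
  have "\<exists>N. \<forall>n x. N \<le> n \<and> x \<in> {0..1} \<longrightarrow>
      \<bar>g x \<bullet> b - (\<Sum>k\<le>n. (g (real k / real n) \<bullet> b) * Bernstein n k x)\<bar> < e / DIM('a)" for b
    by (rule Bernstein_Weierstrass) (use assms in \<open>auto intro!: continuous_intros\<close>)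
  then obtain N where N: "\<And>b n x. N b \<le> n \<Longrightarrow> x \<in> {0..1} \<Longrightarrow>
      \<bar>g x \<bullet> b - (\<Sum>k\<le>n. (g (real k / real n) \<bullet> b) * Bernstein n k x)\<bar> < e / DIM('a)"
    by metis
  define n where "n = Suc (\<Sum>b\<in>Basis. N b)"
  have n: "N b \<le> n" if "b \<in> Basis" for b
    using member_le_sum[of b Basis N] that by (simp add: n_def le_SucI)
  have "norm (g x - (\<Sum>k\<le>n. Bernstein n k x *\<^sub>R g (real k / real n))) < e" if x: "x \<in> {0..1}" for x
  proof -
    have "norm (g x - (\<Sum>k\<le>n. Bernstein n k x *\<^sub>R g (real k / real n)))
      \<le> (\<Sum>b\<in>Basis. \<bar>(g x - (\<Sum>k\<le>n. Bernstein n k x *\<^sub>R g (real k / real n))) \<bullet> b\<bar>)"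
      by (rule norm_le_l1)
    also have "\<dots> < (\<Sum>b\<in>(Basis::'a set). e / DIM('a))"
    proof (rule sum_strict_mono)
      fix b :: 'a assume b: "b \<in> Basis"
      show "\<bar>(g x - (\<Sum>k\<le>n. Bernstein n k x *\<^sub>R g (real k / real n))) \<bullet> b\<bar> < e / DIM('a)"
        using N[OF n[OF b] x, of ] by (simp add: inner_diff_left inner_sum_left mult.commute)
    qed auto
    finally show ?thesis by simp
  qed
  then show ?thesis by (intro exI[of _ n]) (auto simp: n_def)
qed

lemma smooth_path_polynomial_function:
  fixes p :: "real \<Rightarrow> 'a::euclidean_space"
  assumes "polynomial_function p"
  shows "smooth_path p"
proof -
  define step where "step q = (SOME q'. polynomial_function q' \<and> (\<forall>x. (q has_vector_derivative q' x) (at x)))"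
    for q :: "real \<Rightarrow> 'a"
  have step: "polynomial_function (step q) \<and> (\<forall>x. (q has_vector_derivative step q x) (at x))"
    if q: "polynomial_function q" for q
  proof -
    obtain q' where "polynomial_function q'" "\<And>x. (q has_vector_derivative q' x) (at x)"
      by (rule has_vector_derivative_polynomial_function[OF q]) (rule that)
    then have "\<exists>q'. polynomial_function q' \<and> (\<forall>x. (q has_vector_derivative q' x) (at x))"
      by (intro exI[of _ q']) simp
    then show ?thesis unfolding step_def by (rule someI_ex)
  qed
  have poly: "polynomial_function ((step ^^ n) p)" for n
    by (induction n) (use assms step in auto)
  show ?thesis unfolding smooth_path_def
    by (rule exI[of _ "\<lambda>n. (step ^^ n) p"]) (use step poly in \<open>auto intro: has_vector_derivative_at_within\<close>)
qed

text \<open>Some curve in \<open>D\<close> from \<open>x\<close> to \<open>y\<close> has length at most \<open>l\<close>. The function \<open>\<phi>\<close> bounds the length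
travelled up to a given time; it makes concatenation, reversal and restriction of curves immediate, which they are not for
suprema over inscribed polygons.\<close>

definition joined_within :: "'a::real_normed_vector set \<Rightarrow> real \<Rightarrow> 'a \<Rightarrow> 'a \<Rightarrow> bool" where
  "joined_within D l x y \<longleftrightarrow> (\<exists>g (\<phi> :: real \<Rightarrow> real). continuous_on {0..1} g \<and> g ` {0..1} \<subseteq> D \<and> g 0 = x \<and> g 1 = y \<and>
     \<phi> 1 - \<phi> 0 \<le> l \<and> (\<forall>s t. 0 \<le> s \<and> s \<le> t \<and> t \<le> 1 \<longrightarrow> dist (g s) (g t) \<le> \<phi> t - \<phi> s))"

lemma joined_withinI:
  assumes "continuous_on {0..1} g" "g ` {0..1} \<subseteq> D" "g 0 = x" "g 1 = y" "\<phi> 1 - \<phi> 0 \<le> l"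
    "\<And>s t. 0 \<le> s \<Longrightarrow> s \<le> t \<Longrightarrow> t \<le> 1 \<Longrightarrow> dist (g s) (g t) \<le> \<phi> t - \<phi> (s::real)"
  shows "joined_within D l x y"
  unfolding joined_within_def using assms by blast

lemma joined_within_segment:
  assumes "closed_segment x y \<subseteq> D"
  shows "joined_within D (dist x y) x y"
proof (rule joined_withinI[of "linepath x y" _ _ _ "\<lambda>t. t * dist x y"])
  show "dist (linepath x y s) (linepath x y t) \<le> t * dist x y - s * dist x y" if "s \<le> t" for s t :: real
  proof -
    have "linepath x y s - linepath x y t = (t - s) *\<^sub>R (x - y)"
      by (simp add: linepath_def algebra_simps)
    then show ?thesis using that by (simp add: dist_norm left_diff_distrib)
  qed
qed (use assms in \<open>auto simp: linepath_image_01 linepath_0' linepath_1'\<close>)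

lemma joined_within_sym:
  assumes "joined_within D l x y"
  shows "joined_within D l y x"
proof -
  obtain g \<phi> where g: "continuous_on {0..1} g" "g ` {0..1} \<subseteq> D" "g 0 = x" "g 1 = y" "\<phi> 1 - \<phi> 0 \<le> l"
    "\<And>s t. 0 \<le> s \<and> s \<le> t \<and> t \<le> 1 \<Longrightarrow> dist (g s) (g t) \<le> \<phi> t - \<phi> (s::real)"
    using assms unfolding joined_within_def by blast
  show ?thesis
  proof (rule joined_withinI[of "\<lambda>t. g (1 - t)" _ _ _ "\<lambda>t. - \<phi> (1 - t)"])
    show "continuous_on {0..1} (\<lambda>t. g (1 - t))"
      by (rule continuous_on_compose2[OF g(1)]) (auto intro!: continuous_intros)
    show "dist (g (1 - s)) (g (1 - t)) \<le> - \<phi> (1 - t) - - \<phi> (1 - s)" if "0 \<le> s" "s \<le> t" "t \<le> 1" for s t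
      using g(6)[of "1-t" "1-s"] that by (simp add: dist_commute)
  qed (use g in auto)
qed

lemma joined_within_trans:
  assumes "joined_within D l x y" "joined_within D l' y z"
  shows "joined_within D (l + l') x z"
proof -
  obtain g \<phi> where g: "continuous_on {0..1} g" "g ` {0..1} \<subseteq> D" "g 0 = x" "g 1 = y" "\<phi> 1 - \<phi> 0 \<le> l"
    "\<And>s t. 0 \<le> s \<and> s \<le> t \<and> t \<le> 1 \<Longrightarrow> dist (g s) (g t) \<le> \<phi> t - \<phi> (s::real)"
    using assms unfolding joined_within_def by blast
  obtain g' \<phi>' where g': "continuous_on {0..1} g'" "g' ` {0..1} \<subseteq> D" "g' 0 = y" "g' 1 = z" "\<phi>' 1 - \<phi>' 0 \<le> l'"
    "\<And>s t. 0 \<le> s \<and> s \<le> t \<and> t \<le> 1 \<Longrightarrow> dist (g' s) (g' t) \<le> \<phi>' t - \<phi>' (s::real)"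
    using assms unfolding joined_within_def by blast
  define \<psi> where "\<psi> t = (if t \<le> 1/2 then \<phi> (2*t) else \<phi> 1 + \<phi>' (2*t-1) - \<phi>' 0)" for t
  show ?thesis
  proof (rule joined_withinI[of "g +++ g'" _ _ _ \<psi>])
    have "path (g +++ g')"
      using g g' by (intro path_join_imp) (auto simp: path_def pathstart_def pathfinish_def)
    then show "continuous_on {0..1} (g +++ g')" by (simp add: path_def)
    have "path_image (g +++ g') \<subseteq> D"
      using g g' by (intro subset_path_image_join) (auto simp: path_image_def)
    then show "(g +++ g') ` {0..1} \<subseteq> D" by (simp add: path_image_def)
    show "\<psi> 1 - \<psi> 0 \<le> l + l'" using g g' by (simp add: \<psi>_def)
    show "dist ((g +++ g') s) ((g +++ g') t) \<le> \<psi> t - \<psi> s" if st: "0 \<le> s" "s \<le> t" "t \<le> 1" for s t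
    proof -
      consider "t \<le> 1/2" | "s > 1/2" | "s \<le> 1/2" "t > 1/2" by linarith
      then show ?thesis
      proof cases
        case 1
        then show ?thesis using st g(6)[of "2 * s" "2*t"] by (simp add: joinpaths_def \<psi>_def)
      next
        case 2
        then show ?thesis using st g'(6)[of "2 * s - 1" "2*t-1"] by (simp add: joinpaths_def \<psi>_def)
      next
        case 3
        then show ?thesis
          using st g(6)[of "2 * s" 1] g'(6)[of 0 "2*t-1"] dist_triangle[of "g (2 * s)" "g' (2*t-1)" y] g(4) g'(3)
          by (simp add: joinpaths_def \<psi>_def)
      qed
    qed
  qed (use g g' in \<open>auto simp: joinpaths_def\<close>)
qed

lemma joined_within_subpath:
  assumes "continuous_on {0..1} g" "g ` {0..1} \<subseteq> D" "0 \<le> a" "a \<le> b" "b \<le> 1"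
    "\<And>s t. 0 \<le> s \<Longrightarrow> s \<le> t \<Longrightarrow> t \<le> 1 \<Longrightarrow> dist (g s) (g t) \<le> \<phi> t - \<phi> (s::real)"
  shows "joined_within D (\<phi> b - \<phi> a) (g a) (g b)"
proof -
  have r: "a + t * (b - a) \<in> {0..1}" if "t \<in> {0..1}" for t
  proof -
    have "0 \<le> t * (b - a)" "t * (b - a) \<le> 1 * (b - a)"
      using assms that by (intro mult_nonneg_nonneg mult_right_mono; simp)+
    then show ?thesis using assms by auto
  qed
  show ?thesis
  proof (rule joined_withinI[of "\<lambda>t. g (a + t * (b - a))" _ _ _ "\<lambda>t. \<phi> (a + t * (b - a))"])
    show "continuous_on {0..1} (\<lambda>t. g (a + t * (b - a)))"
      by (rule continuous_on_compose2[OF assms(1)]) (use r in \<open>auto intro!: continuous_intros\<close>)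
    show "dist (g (a + s * (b - a))) (g (a + t * (b - a))) \<le> \<phi> (a + t * (b - a)) - \<phi> (a + s * (b - a))"
      if "0 \<le> s" "s \<le> t" "t \<le> 1" for s t
      using that r[of s] r[of t] assms by (intro assms(6)) (auto intro!: mult_right_mono)
  qed (use assms r in auto)
qed

lemma joined_within_imp_dist_le:
  assumes "joined_within D l x y"
  shows "dist x y \<le> l"
proof -
  obtain g and \<phi> :: "real \<Rightarrow> real" where g: "g 0 = x" "g 1 = y" "\<phi> 1 - \<phi> 0 \<le> l"
    "\<And>s t. 0 \<le> s \<and> s \<le> t \<and> t \<le> 1 \<Longrightarrow> dist (g s) (g t) \<le> \<phi> t - \<phi> (s::real)"
    using assms unfolding joined_within_def by blast
  then show ?thesis using g(4)[of 0 1] by simp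
qed

lemma open_connected_joined_within:
  fixes D :: "'a::real_normed_vector set"
  assumes "open D" "connected D" "x \<in> D" "y \<in> D"
  shows "\<exists>l. joined_within D l x y"
proof (rule connected_equivalence_relation[OF assms(2-4)])
  show "\<exists>l. joined_within D l y x" if "\<exists>l. joined_within D l x y" for x y
    using that joined_within_sym by blast
  show "\<exists>l. joined_within D l x z" if "\<exists>l. joined_within D l x y" "\<exists>l. joined_within D l y z" for x y z
    using that joined_within_trans by blast
  fix a assume "a \<in> D"
  then obtain e where e: "e > 0" "ball a e \<subseteq> D" using assms(1) open_contains_ball by blast
  have "\<exists>l. joined_within D l a x" if "x \<in> ball a e" for x
  proof -
    have "closed_segment a x \<subseteq> ball a e"
      using that e by (intro closed_segment_subset) auto
    then show ?thesis using e joined_within_segment by blast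
  qed
  then show "\<exists>T. openin (top_of_set D) T \<and> a \<in> T \<and> (\<forall>x\<in>T. \<exists>l. joined_within D l a x)"
    using e assms(1) by (intro exI[of _ "ball a e"]) (auto simp: openin_open_eq)
qed

lemma curve_length_le:
  fixes g :: "real \<Rightarrow> 'a::metric_space"
  assumes "a \<le> b" "\<And>s t. a \<le> s \<Longrightarrow> s \<le> t \<Longrightarrow> t \<le> b \<Longrightarrow> dist (g s) (g t) \<le> \<phi> t - \<phi> s"
  shows "curve_length a b g \<le> ennreal (\<phi> b - \<phi> a)"
  unfolding curve_length_def
proof (rule SUP_least)
  fix ts assume "ts \<in> {ts. sorted ts \<and> set ts \<subseteq> {a..b}}"
  then have ts: "sorted ts" "set ts \<subseteq> {a..b}" by auto
  have mono: "\<phi> s \<le> \<phi> t" if "a \<le> s" "s \<le> t" "t \<le> b" for s t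
    using assms(2)[OF that] zero_le_dist[of "g s" "g t"] by linarith
  define n where "n = length ts - 1"
  have in_ab: "ts ! i \<in> {a..b}" if "i < length ts" for i using ts that nth_mem by blast
  show "ennreal (\<Sum>i<length ts - 1. dist (g (ts ! i)) (g (ts ! Suc i))) \<le> ennreal (\<phi> b - \<phi> a)"
  proof (cases "ts = []")
    case True
    then show ?thesis using mono[of a b] assms(1) by simp
  next
    case False
    have "(\<Sum>i<n. dist (g (ts ! i)) (g (ts ! Suc i))) \<le> (\<Sum>i<n. \<phi> (ts ! Suc i) - \<phi> (ts ! i))"
    proof (rule sum_mono)
      fix i assume "i \<in> {..<n}"
      then have "i < length ts" "Suc i < length ts" by (auto simp: n_def)
      then show "dist (g (ts ! i)) (g (ts ! Suc i)) \<le> \<phi> (ts ! Suc i) - \<phi> (ts ! i)"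
        using in_ab[of i] in_ab[of "Suc i"] sorted_nth_mono[OF ts(1), of i "Suc i"] by (intro assms(2)) auto
    qed
    also have "\<dots> = \<phi> (ts ! n) - \<phi> (ts ! 0)"
      by (rule sum_lessThan_telescope)
    also have "\<dots> \<le> \<phi> b - \<phi> a"
      using in_ab[of n] in_ab[of 0] mono[of "ts ! n" b] mono[of a "ts ! 0"] False by (auto simp: n_def)
    finally show ?thesis by (simp add: n_def ennreal_leI)
  qed
qed

lemma curve_length_ge_polygon:
  assumes "sorted ts" "set ts \<subseteq> {a..b}"
  shows "ennreal (\<Sum>i<length ts - 1. dist (g (ts ! i)) (g (ts ! Suc i))) \<le> curve_length a b g"
  unfolding curve_length_def using assms by (intro SUP_upper) auto

text \<open>Here \<open>\<phi>(t)\<close> is the supremum of the lengths of the polygons inscribed in the part of the curve up to time \<open>t\<close>.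
Appending the times \<open>s\<close> and \<open>t\<close> to a polygon that ends before \<open>s\<close> shows that \<open>\<phi>\<close> grows fast enough.\<close>

lemma joined_within_of_curve_length:
  assumes "continuous_on {0..1} g" "g ` {0..1} \<subseteq> D" "curve_length 0 1 g \<le> ennreal l" "0 \<le> l"
  shows "joined_within D l (g 0) (g 1)"
proof -
  define P where "P ts = (\<Sum>i<length ts - 1. dist (g (ts ! i)) (g (ts ! Suc i)))" for ts
  define A where "A t = {P ts |ts. sorted ts \<and> set ts \<subseteq> {0..t}}" for t
  have P_le: "P ts \<le> l" if "sorted ts" "set ts \<subseteq> {0..1}" for ts
    using order_trans[OF curve_length_ge_polygon[OF that] assms(3)] assms(4) unfolding P_def by simp
  have bdd: "bdd_above (A t)" if "t \<le> 1" for t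
    unfolding A_def by (rule bdd_aboveI[of _ l]) (use P_le that in force)
  have ne: "0 \<in> A t" for t unfolding A_def by (force simp: P_def intro: exI[of _ "[]"])
  show ?thesis
  proof (rule joined_withinI[of g _ _ _ "\<lambda>t. Sup (A t)"])
    have "Sup (A 1) \<le> l"
    proof (rule cSup_least)
      show "A 1 \<noteq> {}" using ne[of 1] by blast
      show "p \<le> l" if "p \<in> A 1" for p using that P_le unfolding A_def by auto
    qed
    moreover have "0 \<le> Sup (A 0)" using ne bdd[of 0] by (intro cSup_upper) auto
    ultimately show "Sup (A 1) - Sup (A 0) \<le> l" by simp
    show "dist (g s) (g t) \<le> Sup (A t) - Sup (A s)" if st: "0 \<le> s" "s \<le> t" "t \<le> 1" for s t
    proof -
      have "Sup (A s) \<le> Sup (A t) - dist (g s) (g t)"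
      proof (rule cSup_least)
        show "A s \<noteq> {}" using ne by auto
        fix p assume "p \<in> A s"
        then obtain ts where ts: "p = P ts" "sorted ts" "set ts \<subseteq> {0..s}" unfolding A_def by auto
        let ?us = "ts @ [s, t]"
        have "sorted ?us" using ts st by (auto simp: sorted_append)
        then have m: "P ?us \<in> A t" using ts st unfolding A_def by fastforce
        have "P ts + dist (g s) (g t) =
           (\<Sum>i\<in>{..<length ts - 1} \<union> {length ts}. dist (g (?us ! i)) (g (?us ! Suc i)))"
          unfolding P_def by (subst sum.union_disjoint) (auto simp: nth_append intro!: sum.cong)
        also have "\<dots> \<le> P ?us" unfolding P_def by (intro sum_mono2) auto
        also have "\<dots> \<le> Sup (A t)" using m bdd st by (intro cSup_upper) auto
        finally show "p \<le> Sup (A t) - dist (g s) (g t)" using ts by simp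
      qed
      then show ?thesis by simp
    qed
  qed (use assms in auto)
qed

text \<open>A Bernstein polynomial of the curve has the same ends, is not longer, and stays in the open set \<open>D\<close> if its
degree is large. So the infimum over smooth paths agrees with the one over all rectifiable curves, and
smooth paths need not be joined smoothly in order to prove the triangle inequality.\<close>

lemma joined_within_imp_smooth_path:
  fixes D :: "'a::euclidean_space set"
  assumes "open D" "joined_within D l x y"
  obtains p where "smooth_path p" "path_image p \<subseteq> D" "pathstart p = x" "pathfinish p = y"
    "curve_length 0 1 p \<le> ennreal l"
proof -
  obtain g \<phi> where g: "continuous_on {0..1} g" "g ` {0..1} \<subseteq> D" "g 0 = x" "g 1 = y" "\<phi> 1 - \<phi> 0 \<le> l"
    "\<And>s t. 0 \<le> s \<and> s \<le> t \<and> t \<le> 1 \<Longrightarrow> dist (g s) (g t) \<le> \<phi> t - \<phi> (s::real)"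
    using assms unfolding joined_within_def by blast
  have "compact (g ` {0..1})" using g(1) compact_continuous_image by blast
  then obtain e where e: "e > 0" "{z. infdist z (g ` {0..1}) \<le> e} \<subseteq> D"
    using compact_in_open_separated[OF _ _ assms(1) g(2)] by (metis atLeastAtMost_iff empty_iff image_is_empty zero_le_one order_refl)
  obtain n where n: "n > 0" "\<forall>t\<in>{0..1}. norm (g t - (\<Sum>k\<le>n. Bernstein n k t *\<^sub>R g (real k / real n))) < e"
    using Bernstein_Weierstrass_vector[OF g(1) e(1)] by blast
  define p where "p t = (\<Sum>k\<le>n. Bernstein n k t *\<^sub>R g (real k / real n))" for t
  define \<psi> where "\<psi> t = (\<Sum>k\<le>n. Bernstein n k t * \<phi> (real k / real n))" for t
  have "real_polynomial_function (\<lambda>t::real. real (n choose k) * t ^ k * (1 - t) ^ (n - k))" for k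
    by (intro real_polynomial_function.intros(2,4) real_polynomial_function_power real_polynomial_function_diff
        real_polynomial_function.intros(1) bounded_linear_ident)
  then have "polynomial_function p"
    unfolding p_def Bernstein_def
    by (intro polynomial_function_sum polynomial_function_mult) (auto simp flip: real_polynomial_function_eq)
  then have sm: "smooth_path p" by (rule smooth_path_polynomial_function)
  have inD: "p t \<in> D" if "t \<in> {0..1}" for t
  proof -
    have "infdist (p t) (g ` {0..1}) \<le> dist (p t) (g t)" using that by (intro infdist_le) auto
    also have "\<dots> \<le> e" using n that by (simp add: p_def dist_norm norm_minus_commute less_imp_le)
    finally show ?thesis using e by auto
  qed
  have ends: "p 0 = x" "p 1 = y" "\<psi> 0 = \<phi> 0" "\<psi> 1 = \<phi> 1"
    using g n(1) Bernstein_endpoints[where c = "\<lambda>k. g (real k / real n)"] Bernstein_endpoints[where c = "\<lambda>k. \<phi> (real k / real n)"]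
    by (auto simp: p_def \<psi>_def)
  have "curve_length 0 1 p \<le> ennreal (\<psi> 1 - \<psi> 0)"
  proof (rule curve_length_le)
    fix s t :: real assume st: "0 \<le> s" "s \<le> t" "t \<le> 1"
    have "norm (p t - p s) \<le> \<psi> t - \<psi> s"
      unfolding p_def \<psi>_def
    proof (rule Bernstein_sum_increment_le[OF _ st])
      fix k assume "k < n"
      then show "norm (g (real (Suc k) / real n) - g (real k / real n)) \<le> \<phi> (real (Suc k) / real n) - \<phi> (real k / real n)"
        using g(6)[of "real k / real n" "real (Suc k) / real n"]
        by (simp add: dist_norm norm_minus_commute divide_right_mono)
    qed
    then show "dist (p s) (p t) \<le> \<psi> t - \<psi> s" by (simp add: dist_norm norm_minus_commute)
  qed simp
  also have "\<dots> \<le> ennreal l" using g(5) ends by (intro ennreal_leI) simp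
  finally show ?thesis
    using inD ends by (intro that[OF sm]) (auto simp: path_image_def pathstart_def pathfinish_def)
qed

lemma smooth_path_imp_continuous_on: "smooth_path g \<Longrightarrow> continuous_on {0..1} g"
  unfolding smooth_path_def by (metis (mono_tags, lifting) continuous_on_vector_derivative)

context
  fixes D :: "'a::euclidean_space set"
  assumes D: "open D" "connected D"
begin

lemma intr_dist_on_le:
  assumes "joined_within D l x y"
  shows "intr_dist_on D x y \<le> l"
proof -
  have l: "0 \<le> l" using joined_within_imp_dist_le[OF assms] zero_le_dist order_trans by blast
  obtain p where p: "smooth_path p" "path_image p \<subseteq> D" "pathstart p = x" "pathfinish p = y"
    "curve_length 0 1 p \<le> ennreal l"
    using joined_within_imp_smooth_path[OF D(1) assms] .
  have "(INF g \<in> {g. smooth_path g \<and> path_image g \<subseteq> D \<and> pathstart g = x \<and> pathfinish g = y}.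
                 curve_length 0 1 g) \<le> ennreal l"
    using p by (intro INF_lower2) auto
  then show ?thesis unfolding intr_dist_on_def using l enn2real_leI by blast
qed

lemma joined_within_intr_dist_on:
  assumes "x \<in> D" "y \<in> D" "e > 0"
  shows "joined_within D (intr_dist_on D x y + e) x y"
proof -
  define S where "S = {g. smooth_path g \<and> path_image g \<subseteq> D \<and> pathstart g = x \<and> pathfinish g = y}"
  define I where "I = (INF g\<in>S. curve_length 0 1 g)"
  obtain l where "joined_within D l x y" using open_connected_joined_within D assms by blast
  then obtain p where "p \<in> S" "curve_length 0 1 p \<le> ennreal l"
    using joined_within_imp_smooth_path[OF D(1)] unfolding S_def by blast
  then have "I \<le> ennreal l" unfolding I_def by (intro INF_lower2)
  then have fin: "I < top" using ennreal_less_top le_less_trans by blast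
  then have I: "I = ennreal (intr_dist_on D x y)"
    unfolding intr_dist_on_def S_def[symmetric] I_def[symmetric] by simp
  have "0 \<le> intr_dist_on D x y" by (simp add: intr_dist_on_def)
  then have "I < ennreal (intr_dist_on D x y + e)" unfolding I using assms
    by (simp add: ennreal_less_iff)
  then obtain g where g: "g \<in> S" "curve_length 0 1 g < ennreal (intr_dist_on D x y + e)"
    unfolding I_def INF_less_iff by blast
  then show ?thesis
    using joined_within_of_curve_length[of g D "intr_dist_on D x y + e"] assms \<open>0 \<le> intr_dist_on D x y\<close>
    by (auto simp: S_def path_image_def pathstart_def pathfinish_def dest: smooth_path_imp_continuous_on)
qed

lemma intr_dist_on_sym_le:
  assumes "x \<in> D" "y \<in> D"
  shows "intr_dist_on D x y \<le> intr_dist_on D y x"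
  by (rule field_le_epsilon) (use assms intr_dist_on_le joined_within_sym joined_within_intr_dist_on in blast)

lemma intr_dist_on_sym:
  assumes "x \<in> D" "y \<in> D"
  shows "intr_dist_on D x y = intr_dist_on D y x"
  using intr_dist_on_sym_le assms by (simp add: order_antisym)

lemma intr_dist_on_triangle:
  assumes "x \<in> D" "y \<in> D" "z \<in> D"
  shows "intr_dist_on D x z \<le> intr_dist_on D x y + intr_dist_on D y z"
proof (rule field_le_epsilon)
  fix e :: real assume "e > 0"
  then have "joined_within D (intr_dist_on D x y + e/2) x y" "joined_within D (intr_dist_on D y z + e/2) y z"
    using assms joined_within_intr_dist_on by auto
  from intr_dist_on_le[OF joined_within_trans[OF this]]
  show "intr_dist_on D x z \<le> intr_dist_on D x y + intr_dist_on D y z + e" by simp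
qed

lemma dist_le_intr_dist_on:
  assumes "x \<in> D" "y \<in> D"
  shows "dist x y \<le> intr_dist_on D x y"
  by (rule field_le_epsilon) (use assms joined_within_imp_dist_le joined_within_intr_dist_on in blast)

lemma intr_dist_on_segment:
  assumes "closed_segment x y \<subseteq> D"
  shows "intr_dist_on D x y \<le> dist x y"
  using assms intr_dist_on_le joined_within_segment by blast

text \<open>The intermediate value theorem along an almost shortest curve.\<close>

lemma intr_dist_on_approx_between:
  assumes "x \<in> D" "y \<in> D" "0 \<le> a" "a \<le> intr_dist_on D x y" "e > 0"
    and cont: "continuous_on D (intr_dist_on D x)"
  obtains p where "p \<in> D" "intr_dist_on D x p = a" "intr_dist_on D p y \<le> intr_dist_on D x y - a + e"
proof -
  obtain g \<phi> where g: "continuous_on {0..1} g" "g ` {0..1} \<subseteq> D" "g 0 = x" "g 1 = y" 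
    "\<phi> 1 - \<phi> 0 \<le> intr_dist_on D x y + e"
    "\<And>s t. 0 \<le> s \<Longrightarrow> s \<le> t \<Longrightarrow> t \<le> 1 \<Longrightarrow> dist (g s) (g t) \<le> \<phi> t - \<phi> (s::real)"
    using joined_within_intr_dist_on[OF assms(1,2,5)] unfolding joined_within_def by blast
  have x0: "intr_dist_on D x x = 0"
    using intr_dist_on_segment[of x x] dist_le_intr_dist_on[of x x] assms by auto
  have "continuous_on {0..1} (\<lambda>t. intr_dist_on D x (g t))"
    by (rule continuous_on_compose2[OF cont g(1,2)])
  then obtain t where t: "0 \<le> t" "t \<le> 1" "intr_dist_on D x (g t) = a"
    using IVT'[of "\<lambda>t. intr_dist_on D x (g t)" 0 a 1] g x0 assms by auto
  have "intr_dist_on D x (g t) \<le> \<phi> t - \<phi> 0" "intr_dist_on D (g t) y \<le> \<phi> 1 - \<phi> t"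
    using joined_within_subpath[OF g(1,2), of 0 t] joined_within_subpath[OF g(1,2), of t 1] t g intr_dist_on_le
    by auto
  moreover have "g t \<in> D" using g t by auto
  ultimately show ?thesis using that[of "g t"] t g by auto
qed

end

section \<open>The exterior sphere and interior cone conditions\<close>

lemma norm_sq_add: "(norm (a + b))\<^sup>2 = (norm a)\<^sup>2 + 2 * (a \<bullet> b) + (norm b)\<^sup>2"
  for a b :: "'a::real_inner"
  by (simp add: power2_norm_eq_inner inner_add inner_commute)

lemma norm_sq_diff: "(norm (a - b))\<^sup>2 = (norm a)\<^sup>2 - 2 * (a \<bullet> b) + (norm b)\<^sup>2"
  for a b :: "'a::real_inner"
  by (simp add: power2_norm_eq_inner inner_diff inner_commute)

text \<open>The point \<open>m\<close> is the point of the closure nearest to the midpoint \<open>z\<close>. The direction from \<open>m\<close> to \<open>z\<close> is an exterior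
normal for the radius \<open>h = |z - m|\<close>, hence for the radius \<open>r\<close>. The ball of radius \<open>r\<close> that touches at \<open>m\<close>
contains neither \<open>p\<close> nor \<open>q\<close>, which gives \<open>4 r h \<le> |p - m|\<^sup>2 + |q - m|\<^sup>2\<close>. Together with the parallelogram law
this forces \<open>h\<close> to be quadratically small in \<open>|p - q|\<close>.\<close>

lemma exterior_sphere_near_midpoint:
  fixes D :: "'a::euclidean_space set"
  assumes "open D" "0 < r" "uniform_exterior_sphere r D"
    and p: "p \<in> closure D" and q: "q \<in> closure D" and pq: "dist p q \<le> r"
  obtains m where "m \<in> closure D" "dist p m \<le> 2/3 * dist p q" "dist m q \<le> 2/3 * dist p q"
    "dist p m + dist m q \<le> dist p q + dist p q ^ 3 / (18 * r\<^sup>2)"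
proof -
  define z where "z = midpoint p q"
  define L where "L = dist p q"
  obtain m where m: "m \<in> closure D" "\<And>y. y \<in> closure D \<Longrightarrow> dist z m \<le> dist z y"
    by (rule distance_attains_inf[of "closure D" z]) (use p in auto)
  define h where "h = dist z m"
  have zp: "dist z p = L / 2" "dist z q = L / 2"
    by (simp_all add: z_def L_def dist_midpoint)
  have h: "0 \<le> h" "h \<le> L / 2" using m(2)[OF p] zp by (auto simp: h_def)
  have L: "0 \<le> L" "L \<le> r" using pq by (auto simp: L_def)
  have key: "4 * r * h \<le> (norm (p - m))\<^sup>2 + (norm (q - m))\<^sup>2"
  proof (cases "h = 0")
    case False
    then have h0: "h > 0" using h by simp
    define \<nu> where "\<nu> = (1 / h) *\<^sub>R (z - m)"
    have n\<nu>: "norm \<nu> = 1" using h0 by (simp add: \<nu>_def h_def dist_norm)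
    have h\<nu>: "h *\<^sub>R \<nu> = z - m" using h0 by (simp add: \<nu>_def)
    have disj: "ball z h \<inter> D = {}"
      using m(2) closure_subset[of D] by (force simp: h_def)
    have "m \<notin> D"
    proof
      assume "m \<in> D"
      then have "D \<inter> closure (ball z h) \<noteq> {}" using h0 by (auto simp: h_def)
      then show False using open_Int_closure_eq_empty[OF assms(1), of "ball z h"] disj by blast
    qed
    then have fr: "m \<in> frontier D" using m assms(1) by (simp add: frontier_def interior_open)
    \<comment> \<open>the exterior ball of the small radius \<open>h\<close> may be enlarged to the radius \<open>r\<close>\<close>
    have "\<nu> \<in> ext_normals D m h" using n\<nu> disj by (simp add: ext_normals_def h\<nu>)
    then have "\<nu> \<in> ext_normals D m r"
      using assms(3) fr h0 h L unfolding uniform_exterior_sphere_def by fastforce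
    then have "ball (m + r *\<^sub>R \<nu>) r \<inter> closure D = {}"
      using open_Int_closure_eq_empty[OF open_ball] by (auto simp: ext_normals_def)
    then have out: "2 * r * ((x - m) \<bullet> \<nu>) \<le> (norm (x - m))\<^sup>2" if "x \<in> closure D" for x
    proof -
      have "r \<le> norm ((x - m) - r *\<^sub>R \<nu>)"
        using that \<open>ball (m + r *\<^sub>R \<nu>) r \<inter> closure D = {}\<close>
        by (force simp: dist_norm norm_minus_commute algebra_simps)
      then have "r\<^sup>2 \<le> (norm ((x - m) - r *\<^sub>R \<nu>))\<^sup>2" using assms(2) by (intro power_mono) auto
      also have "\<dots> = (norm (x - m))\<^sup>2 - 2 * r * ((x - m) \<bullet> \<nu>) + r\<^sup>2"
        unfolding norm_sq_diff[of "x - m"] using n\<nu> by simp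
      finally show ?thesis by simp
    qed
    have "(p - m) + (q - m) = (2 * h) *\<^sub>R \<nu>"
      using h\<nu> by (simp add: z_def midpoint_def scaleR_2 flip: scaleR_scaleR) (simp add: algebra_simps flip: scaleR_2)
    then have "(p - m) \<bullet> \<nu> + (q - m) \<bullet> \<nu> = 2 * h"
      using n\<nu> by (simp add: norm_eq_1 flip: inner_add_left)
    then have "2 * r * ((p - m) \<bullet> \<nu>) + 2 * r * ((q - m) \<bullet> \<nu>) = 4 * r * h"
      by (simp flip: distrib_left)
    then show ?thesis using out[OF p] out[OF q] by simp
  qed auto
  have par: "(norm (p - m))\<^sup>2 + (norm (q - m))\<^sup>2 = 2 * h\<^sup>2 + L\<^sup>2 / 2"
  proof -
    have e: "p - m = (1/2) *\<^sub>R (p - q) + (z - m)" "q - m = (z - m) - (1/2) *\<^sub>R (p - q)"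
      by (simp_all add: z_def midpoint_def algebra_simps flip: scaleR_2)
    have "(norm (p - m))\<^sup>2 + (norm (q - m))\<^sup>2 = 2 * (norm (z - m))\<^sup>2 + (norm (p - q))\<^sup>2 / 2"
      unfolding e norm_sq_add[of "(1/2) *\<^sub>R (p - q)"] norm_sq_diff[of "z - m"]
      by (simp add: inner_commute power_mult_distrib power_divide)
    then show ?thesis by (simp add: h_def L_def dist_norm)
  qed
  have "2 * h\<^sup>2 \<le> r * h"
    using mult_right_mono[of "2 * h" r h] h L by (simp add: power2_eq_square mult.assoc)
  then have hr: "6 * r * h \<le> L\<^sup>2" using key par by simp
  also have "L\<^sup>2 \<le> r * L" using L by (simp add: power2_eq_square mult_right_mono)
  finally have "r * (6 * h) \<le> r * L" by (simp add: algebra_simps)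
  then have h6: "6 * h \<le> L" using assms(2) by simp
  have "dist p m \<le> L / 2 + h" "dist m q \<le> L / 2 + h"
    using dist_triangle[of p m z] dist_triangle[of m q z] zp by (auto simp: h_def dist_commute)
  then have 1: "dist p m \<le> 2/3 * L" "dist m q \<le> 2/3 * L" using h6 by auto
  have "(dist p m + dist m q)\<^sup>2 \<le> 2 * ((dist p m)\<^sup>2 + (dist m q)\<^sup>2)"
    using sum_squares_bound[of "dist p m" "dist m q"] by (simp add: power2_sum)
  also have "\<dots> = 4 * h\<^sup>2 + L\<^sup>2"
    using par by (simp add: dist_norm norm_minus_commute)
  also have "\<dots> \<le> (L + L ^ 3 / (18 * r\<^sup>2))\<^sup>2"
  proof -
    have "h \<le> L\<^sup>2 / (6 * r)" using hr assms(2) by (simp add: field_simps)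
    then have "h\<^sup>2 \<le> (L\<^sup>2 / (6 * r))\<^sup>2" using h by (intro power_mono) auto
    then have "4 * h\<^sup>2 \<le> L ^ 4 / (9 * r\<^sup>2)" by (simp add: power_divide power_mult_distrib field_simps flip: power_mult)
    moreover have "(L + L ^ 3 / (18 * r\<^sup>2))\<^sup>2 = L\<^sup>2 + L ^ 4 / (9 * r\<^sup>2) + (L ^ 3 / (18 * r\<^sup>2))\<^sup>2"
      unfolding power2_sum by (simp add: power_numeral_reduce)
    ultimately show ?thesis using zero_le_power2[of "L ^ 3 / (18 * r\<^sup>2)"] by linarith
  qed
  finally have "dist p m + dist m q \<le> L + L ^ 3 / (18 * r\<^sup>2)"
    by (rule power2_le_imp_le) (use L in auto)
  then show ?thesis using that[OF m(1)] 1 by (auto simp: L_def)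
qed

text \<open>An open cone contains a ball around a point of its axis. It may be based at points of the closure as well,
since a vector that lies in the open cone at \<open>p\<close> also lies in the cone at nearby points of \<open>D\<close>.\<close>

lemma interior_cone_shift:
  fixes D :: "'a::euclidean_space set"
  assumes "0 < \<alpha>" "\<alpha> \<le> pi / 2" "uniform_interior_cone \<delta> \<alpha> D" "x \<in> frontier D"
  obtains m \<sigma> where "norm m = 1" "0 < \<sigma>" "\<sigma> \<le> 1"
    "\<And>p \<epsilon> w. p \<in> closure D \<Longrightarrow> dist x p < \<delta> \<Longrightarrow> 0 < \<epsilon> \<Longrightarrow> norm w < \<sigma> * \<epsilon> \<Longrightarrow>
       dist x (p + \<epsilon> *\<^sub>R m + w) < \<delta> \<Longrightarrow> p + \<epsilon> *\<^sub>R m + w \<in> D"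
proof -
  obtain m where m: "norm m = 1" "\<forall>y\<in>D \<inter> ball x \<delta>. (+) y ` open_cone \<alpha> m \<inter> ball x \<delta> \<subseteq> D"
    using assms(3,4) unfolding uniform_interior_cone_def by blast
  have "open (open_cone \<alpha> m)" unfolding open_cone_def
    by (intro open_Collect_less continuous_intros)
  moreover have "m \<in> open_cone \<alpha> m"
  proof -
    have "cos \<alpha> < cos 0" using assms by (intro cos_monotone_0_pi) auto
    moreover have "m \<bullet> m = 1" using m(1) by (simp add: norm_eq_1)
    ultimately show ?thesis using m(1) by (simp add: open_cone_def)
  qed
  ultimately obtain \<sigma>0 where \<sigma>0: "\<sigma>0 > 0" "ball m \<sigma>0 \<subseteq> open_cone \<alpha> m"
    using open_contains_ball by blast
  define \<sigma> where "\<sigma> = min \<sigma>0 1"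
  show ?thesis
  proof (rule that[OF m(1), of \<sigma>])
    show "\<sigma> > 0" "\<sigma> \<le> 1" using \<sigma>0 by (auto simp: \<sigma>_def)
    fix p \<epsilon> w assume p: "p \<in> closure D" "dist x p < \<delta>" and \<epsilon>: "0 < \<epsilon>" and w: "norm w < \<sigma> * \<epsilon>"
      and z: "dist x (p + \<epsilon> *\<^sub>R m + w) < \<delta>"
    have "\<sigma> * \<epsilon> \<le> \<sigma>0 * \<epsilon>" using \<epsilon> by (intro mult_right_mono) (auto simp: \<sigma>_def)
    then have "norm w < \<epsilon> * \<sigma>0" using w by (simp add: mult.commute)
    then have "m + (1 / \<epsilon>) *\<^sub>R w \<in> ball m \<sigma>0" using \<epsilon> by (simp add: dist_norm field_simps)
    then have "m + (1 / \<epsilon>) *\<^sub>R w \<in> open_cone \<alpha> m" using \<sigma>0 by blast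
    then have "norm (\<epsilon> *\<^sub>R (m + (1 / \<epsilon>) *\<^sub>R w)) * cos \<alpha> < (\<epsilon> *\<^sub>R (m + (1 / \<epsilon>) *\<^sub>R w)) \<bullet> m"
      using \<epsilon> unfolding open_cone_def by (simp add: mult.assoc)
    moreover have "\<epsilon> *\<^sub>R (m + (1 / \<epsilon>) *\<^sub>R w) = \<epsilon> *\<^sub>R m + w" using \<epsilon> by (simp add: scaleR_add_right)
    ultimately have c: "\<epsilon> *\<^sub>R m + w \<in> open_cone \<alpha> m" by (simp add: open_cone_def)
    define z where "z = p + \<epsilon> *\<^sub>R m + w"
    define U where "U = {y. z - y \<in> open_cone \<alpha> m} \<inter> ball x \<delta>"
    have "open U" unfolding U_def open_cone_def mem_Collect_eq
      by (intro open_Int open_Collect_less continuous_intros open_ball)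
    moreover have "p \<in> U" using c p by (simp add: U_def z_def add.assoc)
    ultimately obtain y where y: "y \<in> D" "y \<in> U"
      using p(1) by (metis Int_iff closure_iff_nhds_not_empty disjoint_iff open_Int_closure_eq_empty)
    have "y + (z - y) \<in> (+) y ` open_cone \<alpha> m" using y(2) unfolding U_def by blast
    then have "z \<in> (+) y ` open_cone \<alpha> m \<inter> ball x \<delta>" using z by (simp add: z_def)
    then show "p + \<epsilon> *\<^sub>R m + w \<in> D" using m(2)[rule_format, of y] y by (auto simp: U_def z_def)
  qed
qed

text \<open>Bisection by \<open>exterior_sphere_near_midpoint\<close> refines \<open>{u, v}\<close> to a chain of short steps in the closure. Shifted by
\<open>\<epsilon> m\<close> along the axis of the cone, steps that are short in comparison with \<open>\<epsilon>\<close> are segments in \<open>D\<close>.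
One bisection lengthens a step \<open>L\<close> by at most \<open>L\<^sup>3 / (18 r\<^sup>2)\<close>, and the cubes of the two new steps add up to at most
\<open>L\<^sup>3 / 2\<close>. So the errors of all generations form a geometric series with sum \<open>L\<^sup>3 / (9 r\<^sup>2)\<close>. The hypothesis
on \<open>dist x u + 3 * dist u v\<close> is inherited by both halves and keeps the chain close to \<open>x\<close>.\<close>

lemma intr_dist_on_le_near_frontier:
  fixes D :: "'a::euclidean_space set"
  assumes D: "open D" "connected D" and r: "0 < r" "uniform_exterior_sphere r D"
    and \<alpha>: "0 < \<alpha>" "\<alpha> \<le> pi / 2" and \<delta>: "0 < \<delta>" "uniform_interior_cone \<delta> \<alpha> D" and x: "x \<in> frontier D"
    and u: "u \<in> D" and v: "v \<in> D" and xu: "dist x u + 3 * dist u v \<le> \<delta> / 2" and uv: "dist u v \<le> r"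
  shows "intr_dist_on D u v \<le> dist u v + dist u v ^ 3 / (9 * r\<^sup>2)"
proof -
  obtain m \<sigma> where m: "norm m = 1" and \<sigma>: "0 < \<sigma>" "\<sigma> \<le> 1"
    and cone: "\<And>p \<epsilon> w. p \<in> closure D \<Longrightarrow> dist x p < \<delta> \<Longrightarrow> 0 < \<epsilon> \<Longrightarrow> norm w < \<sigma> * \<epsilon> \<Longrightarrow>
       dist x (p + \<epsilon> *\<^sub>R m + w) < \<delta> \<Longrightarrow> p + \<epsilon> *\<^sub>R m + w \<in> D"
    by (rule interior_cone_shift[OF \<alpha> \<delta>(2) x]) (rule that)
  have shift: "p + \<epsilon> *\<^sub>R m + w \<in> D"
    if p: "p \<in> closure D" "dist x p \<le> \<delta> / 2" and \<epsilon>: "0 < \<epsilon>" "\<epsilon> \<le> \<delta> / 8" and w: "norm w < \<sigma> * \<epsilon>" for p \<epsilon> w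
  proof (rule cone[OF p(1) _ \<epsilon>(1) w])
    have "norm (\<epsilon> *\<^sub>R m + w) \<le> norm (\<epsilon> *\<^sub>R m) + norm w" by (rule norm_triangle_ineq)
    also have "norm (\<epsilon> *\<^sub>R m) + norm w \<le> \<epsilon> + \<epsilon>"
    proof -
      have "\<sigma> * \<epsilon> \<le> 1 * \<epsilon>" using \<sigma> \<epsilon> by (intro mult_right_mono) auto
      then have "norm w \<le> \<epsilon>" using w by linarith
      then show ?thesis using \<epsilon> m by simp
    qed
    also have "\<dots> \<le> \<delta> / 4" using \<epsilon> by simp
    finally have "dist (p + \<epsilon> *\<^sub>R m + w) p \<le> \<delta> / 4" by (simp add: dist_norm add.assoc)
    then show "dist x (p + \<epsilon> *\<^sub>R m + w) < \<delta>"
      using dist_triangle2[of x "p + \<epsilon> *\<^sub>R m + w" p] p \<delta> by linarith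
  qed (use p \<delta> in auto)
  define \<kappa> where "\<kappa> = 1 / (9 * r\<^sup>2)"
  have \<kappa>: "\<kappa> \<ge> 0" by (simp add: \<kappa>_def)
  have refine: "intr_dist_on D (p + \<epsilon> *\<^sub>R m) (q + \<epsilon> *\<^sub>R m) \<le> dist p q + \<kappa> * dist p q ^ 3"
    if \<epsilon>: "0 < \<epsilon>" "\<epsilon> \<le> \<delta> / 8" and "p \<in> closure D" "q \<in> closure D" "dist p q \<le> r"
      "dist x p + 3 * dist p q \<le> \<delta> / 2" "dist p q \<le> (3/2) ^ n * (\<sigma> * \<epsilon> / 2)" for p q n \<epsilon>
    using that(3-)
  proof (induction n arbitrary: p q)
    case 0
    have "closed_segment (p + \<epsilon> *\<^sub>R m) (q + \<epsilon> *\<^sub>R m) \<subseteq> D"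
    proof
      fix z assume "z \<in> closed_segment (p + \<epsilon> *\<^sub>R m) (q + \<epsilon> *\<^sub>R m)"
      then obtain t where t: "0 \<le> t" "t \<le> 1" "z = p + \<epsilon> *\<^sub>R m + t *\<^sub>R (q - p)"
        by (auto simp: in_segment algebra_simps)
      have "norm (t *\<^sub>R (q - p)) \<le> 1 * dist p q"
        using t by (simp add: dist_norm norm_minus_commute mult_left_le_one_le)
      also have "\<dots> < \<sigma> * \<epsilon>"
      proof -
        have "0 < \<sigma> * \<epsilon>" using \<sigma> \<epsilon> by simp
        then show ?thesis using 0(5) by simp
      qed
      finally show "z \<in> D" unfolding t(3) using 0 by (intro shift \<epsilon>) (auto intro: order_trans[rotated])
    qed
    then have "intr_dist_on D (p + \<epsilon> *\<^sub>R m) (q + \<epsilon> *\<^sub>R m) \<le> dist (p + \<epsilon> *\<^sub>R m) (q + \<epsilon> *\<^sub>R m)"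
      by (rule intr_dist_on_segment[OF D])
    then show ?case using \<kappa> by (simp add: add_increasing2)
  next
    case (Suc n)
    define L where "L = dist p q"
    obtain c where c: "c \<in> closure D" and c1: "dist p c \<le> 2/3 * L" and c2: "dist c q \<le> 2/3 * L"
      and c3: "dist p c + dist c q \<le> L + L ^ 3 / (18 * r\<^sup>2)"
      using exterior_sphere_near_midpoint[OF D(1) r Suc.prems(1,2,3)] unfolding L_def by metis
    have L: "0 \<le> L" "L \<le> r" "dist x p + 3 * L \<le> \<delta> / 2" "2/3 * L \<le> (3/2) ^ n * (\<sigma> * \<epsilon> / 2)"
      using Suc.prems by (auto simp: L_def)
    have xc: "dist x c \<le> dist x p + 2/3 * L" using dist_triangle[of x c p] c1 by simp
    have xq: "dist x q \<le> dist x p + L" using dist_triangle[of x q p] by (simp add: L_def)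
    have i1: "intr_dist_on D (p + \<epsilon> *\<^sub>R m) (c + \<epsilon> *\<^sub>R m) \<le> dist p c + \<kappa> * dist p c ^ 3"
      by (rule Suc.IH) (use L c c1 Suc.prems in auto)
    have i2: "intr_dist_on D (c + \<epsilon> *\<^sub>R m) (q + \<epsilon> *\<^sub>R m) \<le> dist c q + \<kappa> * dist c q ^ 3"
      by (rule Suc.IH) (use L c c2 xc Suc.prems in auto)
    have inD: "p + \<epsilon> *\<^sub>R m \<in> D" "c + \<epsilon> *\<^sub>R m \<in> D" "q + \<epsilon> *\<^sub>R m \<in> D"
      using shift[of p \<epsilon> 0] shift[of c \<epsilon> 0] shift[of q \<epsilon> 0] c Suc.prems(1,2) L xc xq \<epsilon> \<sigma> by auto
    have cube: "dist p c ^ 3 + dist c q ^ 3 \<le> L ^ 3 / 2"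
    proof -
      have sq: "t ^ 3 \<le> (4/9) * L\<^sup>2 * t" if "0 \<le> t" "t \<le> 2/3 * L" for t
      proof -
        have "t\<^sup>2 \<le> (2/3 * L)\<^sup>2" using that by (intro power_mono)
        then have "t\<^sup>2 * t \<le> (2/3 * L)\<^sup>2 * t" using that by (intro mult_right_mono)
        then show ?thesis by (simp add: power_numeral_reduce)
      qed
      have "L\<^sup>2 \<le> r\<^sup>2" using L by (intro power_mono)
      then have "L\<^sup>2 / (18 * r\<^sup>2) \<le> 1 / 18" using r by (simp add: field_simps)
      then have "L * (L\<^sup>2 / (18 * r\<^sup>2)) \<le> L * (1 / 18)" using L by (intro mult_left_mono)
      then have "L ^ 3 / (18 * r\<^sup>2) \<le> L / 18" by (simp add: power_numeral_reduce)
      then have "dist p c + dist c q \<le> 19 / 18 * L" using c3 by simp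
      then have "(4/9) * L\<^sup>2 * (dist p c + dist c q) \<le> (4/9) * L\<^sup>2 * (19 / 18 * L)" by (intro mult_left_mono) auto
      also have "\<dots> = (76/162) * L ^ 3" by (simp add: power_numeral_reduce)
      also have "\<dots> \<le> L ^ 3 / 2" using L zero_le_power[of L 3] by linarith
      finally have "(4/9) * L\<^sup>2 * (dist p c + dist c q) \<le> L ^ 3 / 2" .
      then show ?thesis using sq[of "dist p c"] sq[of "dist c q"] c1 c2 by (simp add: distrib_left)
    qed
    have "L ^ 3 / (18 * r\<^sup>2) = \<kappa> * (L ^ 3 / 2)" by (simp add: \<kappa>_def)
    moreover have "\<kappa> * (dist p c ^ 3 + dist c q ^ 3) \<le> \<kappa> * (L ^ 3 / 2)" using cube \<kappa> by (rule mult_left_mono)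
    moreover have "\<kappa> * L ^ 3 = \<kappa> * (L ^ 3 / 2) + \<kappa> * (L ^ 3 / 2)" by simp
    ultimately show ?case
      using intr_dist_on_triangle[OF D inD] i1 i2 c3 unfolding distrib_left by (simp add: L_def)
  qed
  have pos: "dist x v \<le> \<delta> / 2" "dist x u \<le> \<delta> / 2"
    using dist_triangle[of x v u] xu zero_le_dist[of u v] by linarith+
  have bound: "intr_dist_on D u v \<le> dist u v + \<kappa> * dist u v ^ 3 + 2 * \<epsilon>" if \<epsilon>: "0 < \<epsilon>" "\<epsilon> \<le> \<delta> / 8" for \<epsilon>
  proof -
    have cl: "u \<in> closure D" "v \<in> closure D" using u v closure_subset by auto
    have seg: "intr_dist_on D p (p + \<epsilon> *\<^sub>R m) \<le> \<epsilon> \<and> p + \<epsilon> *\<^sub>R m \<in> D" if p: "p \<in> D" "dist x p \<le> \<delta> / 2" for p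
    proof -
      have pc: "p \<in> closure D" using p closure_subset by auto
      have "closed_segment p (p + \<epsilon> *\<^sub>R m) \<subseteq> D"
      proof
        fix z assume "z \<in> closed_segment p (p + \<epsilon> *\<^sub>R m)"
        then obtain t where t: "0 \<le> t" "t \<le> 1" "z = p + (t * \<epsilon>) *\<^sub>R m"
          by (auto simp: in_segment algebra_simps)
        show "z \<in> D"
        proof (cases "t = 0")
          case False
          have "t * \<epsilon> \<le> 1 * \<epsilon>" using t \<epsilon> by (intro mult_right_mono) auto
          then have "t * \<epsilon> \<le> \<delta> / 8" using \<epsilon> by linarith
          then show ?thesis using shift[OF pc p(2), of "t * \<epsilon>" 0] t False \<epsilon> \<sigma> by simp
        qed (use t p in simp)
      qed
      then show ?thesis using intr_dist_on_segment[OF D, of p "p + \<epsilon> *\<^sub>R m"] m \<epsilon> by (auto simp: dist_norm)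
    qed
    obtain n where "dist u v / (\<sigma> * \<epsilon> / 2) < (3/2) ^ n"
      using real_arch_pow[of "3/2"] by auto
    then have n: "dist u v \<le> (3/2) ^ n * (\<sigma> * \<epsilon> / 2)" using \<sigma> \<epsilon> by (simp add: field_simps)
    have "intr_dist_on D (u + \<epsilon> *\<^sub>R m) (v + \<epsilon> *\<^sub>R m) \<le> dist u v + \<kappa> * dist u v ^ 3"
      by (rule refine[OF \<epsilon> cl uv xu n])
    then show ?thesis
      using seg[OF u pos(2)] seg[OF v pos(1)] u v
        intr_dist_on_triangle[OF D, of u "u + \<epsilon> *\<^sub>R m" v] intr_dist_on_triangle[OF D, of "u + \<epsilon> *\<^sub>R m" "v + \<epsilon> *\<^sub>R m" v]
        intr_dist_on_sym[OF D, of v "v + \<epsilon> *\<^sub>R m"] by simp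
  qed
  have "intr_dist_on D u v \<le> dist u v + \<kappa> * dist u v ^ 3"
  proof (rule field_le_epsilon)
    fix e :: real assume "e > 0"
    then show "intr_dist_on D u v \<le> dist u v + \<kappa> * dist u v ^ 3 + e"
      using bound[of "min (e / 2) (\<delta> / 8)"] \<delta> by linarith
  qed
  then show ?thesis by (simp add: \<kappa>_def)
qed

text \<open>Unless the segment from \<open>u\<close> to \<open>v\<close> lies in \<open>D\<close>, it meets the frontier.\<close>

lemma intr_dist_on_le_cubic:
  fixes D :: "'a::euclidean_space set"
  assumes D: "open D" "connected D" and r: "0 < r" "uniform_exterior_sphere r D"
    and \<alpha>: "0 < \<alpha>" "\<alpha> \<le> pi / 2" and \<delta>: "0 < \<delta>" "uniform_interior_cone \<delta> \<alpha> D"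
    and u: "u \<in> D" and v: "v \<in> D" and uv: "dist u v \<le> min r (\<delta> / 8)"
  shows "intr_dist_on D u v \<le> dist u v + dist u v ^ 3 / (9 * r\<^sup>2)"
proof (cases "closed_segment u v \<subseteq> D")
  case True
  then have "intr_dist_on D u v \<le> dist u v" by (rule intr_dist_on_segment[OF D])
  then show ?thesis by (simp add: add_increasing2)
next
  case False
  then obtain x where x: "x \<in> closed_segment u v" "x \<in> frontier D"
    using connected_Int_frontier[of "closed_segment u v" D] u by auto
  then have "dist x u \<le> dist u v" using segment_bound(1) by (metis dist_norm dist_commute)
  then show ?thesis using x uv by (intro intr_dist_on_le_near_frontier[OF D r \<alpha> \<delta> x(2) u v]) auto
qed

section \<open>Metrics that are Euclidean up to a cubic error\<close>

lemma uniform_polygon_le_curve_length: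
  fixes g :: "real \<Rightarrow> 'a::metric_space"
  assumes "a \<le> b"
  shows "ennreal (\<Sum>i<n. dist (g (a + real i * ((b - a) / n))) (g (a + real (Suc i) * ((b - a) / n)))) \<le> curve_length a b g"
proof -
  define t where "t i = a + real i * ((b - a) / real n)" for i
  define ts where "ts = map t [0..<Suc n]"
  have "mono t" using assms by (auto simp: mono_def t_def intro!: divide_right_mono mult_right_mono)
  then have "sorted ts" unfolding ts_def by (simp add: sorted_iff_nth_mono monoD del: upt_Suc)
  moreover have "set ts \<subseteq> {a..b}"
  proof -
    have "t i \<in> {a..b}" if "i \<le> n" for i
    proof (cases "n = 0")
      case False
      have "t i \<le> t n" "t 0 \<le> t i" using \<open>mono t\<close> that by (auto simp: monoD)
      then show ?thesis using False by (simp add: t_def)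
    qed (use assms in \<open>auto simp: t_def\<close>)
    then show ?thesis by (auto simp: ts_def simp del: upt_Suc)
  qed
  ultimately have "ennreal (\<Sum>i<length ts - 1. dist (g (ts ! i)) (g (ts ! Suc i))) \<le> curve_length a b g"
    by (rule curve_length_ge_polygon)
  also have "(\<Sum>i<length ts - 1. dist (g (ts ! i)) (g (ts ! Suc i))) = (\<Sum>i<n. dist (g (t i)) (g (t (Suc i))))"
    by (intro sum.cong) (auto simp: ts_def simp del: upt_Suc)
  finally show ?thesis by (simp add: t_def)
qed

lemma dist_le_curve_length:
  fixes g :: "real \<Rightarrow> 'a::metric_space"
  assumes "a \<le> b"
  shows "ennreal (dist (g a) (g b)) \<le> curve_length a b g"
  using uniform_polygon_le_curve_length[OF assms, where n = 1 and g = g] by simp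

text \<open>The metric side of the argument depends on the following properties of the intrinsic metric on the closure
only; \<open>\<kappa>\<close> and \<open>\<rho>\<close> control by how much it differs locally from the Euclidean metric.\<close>

locale cubic_metric =
  fixes K :: "'a::euclidean_space set" and d :: "'a \<Rightarrow> 'a \<Rightarrow> real" and \<kappa> \<rho> :: real
  assumes compact: "compact K"
    and sym: "x \<in> K \<Longrightarrow> y \<in> K \<Longrightarrow> d x y = d y x"
    and triangle: "x \<in> K \<Longrightarrow> y \<in> K \<Longrightarrow> z \<in> K \<Longrightarrow> d x z \<le> d x y + d y z"
    and dist_le: "x \<in> K \<Longrightarrow> y \<in> K \<Longrightarrow> dist x y \<le> d x y"
    and le_cubic: "x \<in> K \<Longrightarrow> y \<in> K \<Longrightarrow> dist x y \<le> \<rho> \<Longrightarrow> d x y \<le> dist x y + \<kappa> * dist x y ^ 3"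
    and \<rho>_pos: "0 < \<rho>" and \<kappa>_nonneg: "0 \<le> \<kappa>"
begin

lemma self [simp]: "x \<in> K \<Longrightarrow> d x x = 0"
  using le_cubic[of x x] dist_le[of x x] \<rho>_pos by simp

lemma nonneg: "x \<in> K \<Longrightarrow> y \<in> K \<Longrightarrow> 0 \<le> d x y"
  using dist_le[of x y] zero_le_dist[of x y] by linarith

lemma eq_0D: "x \<in> K \<Longrightarrow> y \<in> K \<Longrightarrow> d x y \<le> 0 \<Longrightarrow> x = y"
  using dist_le[of x y] by (simp flip: dist_le_zero_iff)

lemma le_local:
  assumes "x \<in> K" "y \<in> K" "dist x y \<le> \<rho>" "dist x y \<le> 1"
  shows "d x y \<le> (1 + \<kappa>) * dist x y"
proof -
  have "dist x y ^ 3 \<le> dist x y" using power_decreasing[of 1 3 "dist x y"] assms by simp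
  then have "\<kappa> * dist x y ^ 3 \<le> \<kappa> * dist x y" using \<kappa>_nonneg by (rule mult_left_mono)
  then show ?thesis using le_cubic[OF assms(1-3)] by (simp add: algebra_simps)
qed

lemma tendsto_self:
  assumes "(f \<longlongrightarrow> x) F" "\<forall>\<^sub>F n in F. f n \<in> K" "x \<in> K"
  shows "((\<lambda>n. d (f n) x) \<longlongrightarrow> 0) F"
proof (rule tendsto_sandwich[OF _ _ tendsto_const])
  have lim: "((\<lambda>n. dist (f n) x) \<longlongrightarrow> 0) F" using assms(1) by (rule iffD1[OF tendsto_dist_iff])
  then have "\<forall>\<^sub>F n in F. dist (f n) x < min \<rho> 1"
    using order_tendstoD(2)[OF lim, of "min \<rho> 1"] \<rho>_pos by simp
  then show "\<forall>\<^sub>F n in F. d (f n) x \<le> (1 + \<kappa>) * dist (f n) x"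
    using assms(2) by eventually_elim (intro le_local, use assms(3) in auto)
  show "((\<lambda>n. (1 + \<kappa>) * dist (f n) x) \<longlongrightarrow> 0) F"
    using tendsto_mult_left[OF lim, of "1 + \<kappa>"] by simp
  show "\<forall>\<^sub>F n in F. 0 \<le> d (f n) x" using assms(2) by eventually_elim (use assms(3) nonneg in auto)
qed

lemma tendsto_d:
  assumes "(f \<longlongrightarrow> x) F" "(g \<longlongrightarrow> y) F" "\<forall>\<^sub>F n in F. f n \<in> K" "\<forall>\<^sub>F n in F. g n \<in> K" "x \<in> K" "y \<in> K"
  shows "((\<lambda>n. d (f n) (g n)) \<longlongrightarrow> d x y) F"
proof (rule LIM_zero_cancel, rule Lim_null_comparison)
  show "((\<lambda>n. d (f n) x + d (g n) y) \<longlongrightarrow> 0) F"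
    using tendsto_add[OF tendsto_self[OF assms(1,3,5)] tendsto_self[OF assms(2,4,6)]] by simp
  show "\<forall>\<^sub>F n in F. norm (d (f n) (g n) - d x y) \<le> d (f n) x + d (g n) y"
    using assms(3,4)
  proof eventually_elim
    case (elim n)
    have "d (f n) (g n) \<le> d (f n) x + d x y + d y (g n)" "d x y \<le> d x (f n) + d (f n) (g n) + d (g n) y"
      using elim assms(5,6) triangle[of "f n" x "g n"] triangle[of x y "g n"] triangle[of x "f n" y] triangle[of "f n" "g n" y]
      by auto
    then show ?case using sym[of x "f n"] sym[of y "g n"] elim assms(5,6) by (simp add: abs_le_iff)
  qed
qed

lemma continuous_on_d: "continuous_on (K \<times> K) (\<lambda>(x, y). d x y)"
  unfolding continuous_on_def case_prod_beta
  by (intro ballI tendsto_d tendsto_fst tendsto_snd tendsto_ident_at)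
    (auto simp: eventually_at_filter intro!: always_eventually)

text \<open>An isometric embedding of an interval for \<open>d\<close>. That such curves are those whose Euclidean length equals
\<open>d x y\<close>, parametrised by arc length, is shown in \<open>geodesic_curve_length\<close> and \<open>geodesic_of_curve_length\<close>.\<close>

definition geodesic :: "'a \<Rightarrow> 'a \<Rightarrow> (real \<Rightarrow> 'a) \<Rightarrow> bool" where
  "geodesic x y \<gamma> \<longleftrightarrow> \<gamma> 0 = x \<and> \<gamma> (d x y) = y \<and> \<gamma> ` {0..d x y} \<subseteq> K \<and>
     (\<forall>s t. 0 \<le> s \<and> s \<le> t \<and> t \<le> d x y \<longrightarrow> d (\<gamma> s) (\<gamma> t) = t - s)"

lemma geodesic_mem: "geodesic x y \<gamma> \<Longrightarrow> 0 \<le> s \<Longrightarrow> s \<le> d x y \<Longrightarrow> \<gamma> s \<in> K"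
  unfolding geodesic_def by auto

lemma geodesic_d: "geodesic x y \<gamma> \<Longrightarrow> 0 \<le> s \<Longrightarrow> s \<le> t \<Longrightarrow> t \<le> d x y \<Longrightarrow> d (\<gamma> s) (\<gamma> t) = t - s"
  unfolding geodesic_def by auto

lemma geodesic_ends:
  assumes "geodesic x y \<gamma>" "x \<in> K" "y \<in> K" "0 \<le> s" "s \<le> d x y"
  shows "d x (\<gamma> s) = s" "d (\<gamma> s) y = d x y - s"
  using geodesic_d[OF assms(1), of 0 s] geodesic_d[OF assms(1), of s "d x y"] assms
  unfolding geodesic_def by auto

lemma geodesic_reverse:
  assumes "geodesic x y \<gamma>" "x \<in> K" "y \<in> K"
  shows "geodesic y x (\<lambda>t. \<gamma> (d x y - t))"
proof -
  have "d (\<gamma> (d x y - s)) (\<gamma> (d x y - t)) = t - s" if "0 \<le> s" "s \<le> t" "t \<le> d x y" for s t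
    using geodesic_d[OF assms(1), of "d x y - t" "d x y - s"] that
      sym[of "\<gamma> (d x y - s)" "\<gamma> (d x y - t)"] geodesic_mem[OF assms(1)] by auto
  then show ?thesis using assms sym[of x y] unfolding geodesic_def by auto
qed

lemma geodesic_dist_ge:
  assumes "geodesic x y \<gamma>" "0 \<le> s" "s \<le> t" "t \<le> d x y" "t - s \<le> \<rho>"
  shows "t - s - \<kappa> * (t - s) ^ 3 \<le> dist (\<gamma> s) (\<gamma> t)" "dist (\<gamma> s) (\<gamma> t) \<le> t - s"
proof -
  have m: "\<gamma> s \<in> K" "\<gamma> t \<in> K" using geodesic_mem[OF assms(1)] assms by auto
  show le: "dist (\<gamma> s) (\<gamma> t) \<le> t - s" using dist_le[OF m] geodesic_d[OF assms(1-4)] by simp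
  have "dist (\<gamma> s) (\<gamma> t) ^ 3 \<le> (t - s) ^ 3" using le by (intro power_mono) auto
  then have "\<kappa> * dist (\<gamma> s) (\<gamma> t) ^ 3 \<le> \<kappa> * (t - s) ^ 3" using \<kappa>_nonneg by (rule mult_left_mono)
  then show "t - s - \<kappa> * (t - s) ^ 3 \<le> dist (\<gamma> s) (\<gamma> t)"
    using le_cubic[OF m] le assms(5) geodesic_d[OF assms(1-4)] by simp
qed

text \<open>A curve of length \<open>l\<close> that is cut into \<open>n\<close> pieces of equal length accumulates \<open>n\<close> errors of order \<open>(l / n)\<^sup>3\<close>.
They vanish in the limit, so lengths measured with \<open>d\<close> and with the Euclidean metric agree.\<close>

lemma cubic_error_tendsto: "(\<lambda>n. l + C * (1 / real n)\<^sup>2) \<longlonglongrightarrow> (l :: real)"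
proof -
  have "(\<lambda>n. l + C * (1 / real n)\<^sup>2) \<longlonglongrightarrow> l + C * 0\<^sup>2"
    by (intro tendsto_intros lim_1_over_n)
  then show ?thesis by simp
qed

lemma eventually_step_le: 
  assumes "0 \<le> (l :: real)" shows "\<forall>\<^sub>F n in sequentially. 0 < n \<and> l / real n \<le> \<rho>"
proof -
  have lim: "(\<lambda>n. l * (1 / real n)) \<longlonglongrightarrow> l * 0" by (intro tendsto_intros lim_1_over_n)
  have "\<forall>\<^sub>F n in sequentially. l * (1 / real n) < \<rho>" using order_tendstoD(2)[OF lim, of \<rho>] \<rho>_pos by simp
  then show ?thesis using eventually_gt_at_top[of 0] by eventually_elim auto
qed

lemma step_cubes:
  assumes "0 < n" shows "real n * (l / real n + C * (l / real n) ^ 3) = l + (C * l ^ 3) * (1 / real n)\<^sup>2"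
  using assms by (simp add: field_simps power_numeral_reduce)

lemma geodesic_curve_length:
  assumes \<gamma>: "geodesic x y \<gamma>" and st: "0 \<le> s" "s \<le> t" "t \<le> d x y"
  shows "curve_length s t \<gamma> = ennreal (t - s)"
proof -
  have "curve_length s t \<gamma> \<le> ennreal (id t - id s)"
  proof (rule curve_length_le[OF st(2)])
    fix a b assume "s \<le> a" "a \<le> b" "b \<le> t"
    then show "dist (\<gamma> a) (\<gamma> b) \<le> id b - id a"
      using dist_le[of "\<gamma> a" "\<gamma> b"] geodesic_d[OF \<gamma>, of a b] geodesic_mem[OF \<gamma>] st by simp
  qed
  then have le: "curve_length s t \<gamma> \<le> ennreal (t - s)" by simp
  define c where "c = enn2real (curve_length s t \<gamma>)"
  have "curve_length s t \<gamma> < top" using le ennreal_less_top le_less_trans by blast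
  then have c: "curve_length s t \<gamma> = ennreal c" "0 \<le> c" by (auto simp: c_def)
  define l where "l = t - s"
  have l: "0 \<le> l" using st by (simp add: l_def)
  have "\<forall>\<^sub>F n in sequentially. l + (- \<kappa> * l ^ 3) * (1 / real n)\<^sup>2 \<le> c"
    using eventually_step_le[OF l]
  proof eventually_elim
    case (elim n)
    define h where "h = l / real n"
    have h: "0 \<le> h" "h \<le> \<rho>" using elim l by (auto simp: h_def)
    have "l + (- \<kappa> * l ^ 3) * (1 / real n)\<^sup>2 = (\<Sum>i<n. h + - \<kappa> * h ^ 3)"
      using step_cubes[of n l "- \<kappa>"] elim by (simp add: h_def)
    also have "\<dots> \<le> (\<Sum>i<n. dist (\<gamma> (s + real i * h)) (\<gamma> (s + real (Suc i) * h)))"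
    proof (rule sum_mono)
      fix i assume "i \<in> {..<n}"
      then have "real (Suc i) * h \<le> real n * h" using h by (intro mult_right_mono) auto
      then have "s + real (Suc i) * h \<le> t" using elim by (simp add: h_def l_def)
      then show "h + - \<kappa> * h ^ 3 \<le> dist (\<gamma> (s + real i * h)) (\<gamma> (s + real (Suc i) * h))"
        using geodesic_dist_ge(1)[OF \<gamma>, of "s + real i * h" "s + real (Suc i) * h"] h st
        by (simp add: algebra_simps)
    qed
    finally have "ennreal (l + (- \<kappa> * l ^ 3) * (1 / real n)\<^sup>2) \<le> ennreal c"
      using uniform_polygon_le_curve_length[OF st(2), where n = n and g = \<gamma>] unfolding c(1) h_def l_def
      by (meson ennreal_leI order_trans)
    then show ?case using c(2) by (simp add: ennreal_le_iff)
  qed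
  then have "l \<le> c"
    by (rule tendsto_upperbound[OF cubic_error_tendsto]) simp
  then show ?thesis using le unfolding c(1) l_def by (auto intro!: antisym ennreal_leI)
qed

lemma geodesic_of_curve_length:
  assumes "x \<in> K" "y \<in> K" "\<gamma> 0 = x" "\<gamma> (d x y) = y" and K: "\<gamma> ` {0..d x y} \<subseteq> K"
    and len: "\<And>s t. 0 \<le> s \<Longrightarrow> s \<le> t \<Longrightarrow> t \<le> d x y \<Longrightarrow> curve_length s t \<gamma> = ennreal (t - s)"
  shows "geodesic x y \<gamma>"
proof -
  have lip: "dist (\<gamma> s) (\<gamma> t) \<le> t - s" if "0 \<le> s" "s \<le> t" "t \<le> d x y" for s t
    using dist_le_curve_length[of s t \<gamma>] len[OF that] that by simp
  have le: "d (\<gamma> s) (\<gamma> t) \<le> t - s" if st: "0 \<le> s" "s \<le> t" "t \<le> d x y" for s t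
  proof -
    define l where "l = t - s"
    have l: "0 \<le> l" using st by (simp add: l_def)
    have "\<forall>\<^sub>F n in sequentially. d (\<gamma> s) (\<gamma> t) \<le> l + (\<kappa> * l ^ 3) * (1 / real n)\<^sup>2"
      using eventually_step_le[OF l]
    proof eventually_elim
      case (elim n)
      define h where "h = l / real n"
      have h: "0 \<le> h" "h \<le> \<rho>" using elim l by (auto simp: h_def)
      have le_t: "s + real i * h \<le> t" if "i \<le> n" for i
      proof -
        have "real i * h \<le> real n * h" using h that by (intro mult_right_mono) auto
        then show ?thesis using elim by (simp add: h_def l_def)
      qed
      have mem: "\<gamma> (s + real i * h) \<in> K" if "i \<le> n" for i
        using K le_t[OF that] st h by (auto simp: image_subset_iff)
      have "d (\<gamma> s) (\<gamma> (s + real i * h)) \<le> real i * (h + \<kappa> * h ^ 3)" if "i \<le> n" for i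
        using that
      proof (induction i)
        case 0
        then show ?case using mem[of 0] by simp
      next
        case (Suc i)
        let ?a = "\<gamma> (s + real i * h)" and ?b = "\<gamma> (s + real (Suc i) * h)"
        have ab: "dist ?a ?b \<le> h"
          using lip[of "s + real i * h" "s + real (Suc i) * h"] le_t[OF Suc.prems] st h by (simp add: algebra_simps)
        then have "\<kappa> * dist ?a ?b ^ 3 \<le> \<kappa> * h ^ 3" using \<kappa>_nonneg by (intro mult_left_mono power_mono) auto
        then have "d ?a ?b \<le> h + \<kappa> * h ^ 3"
          using le_cubic[of ?a ?b] mem[of i] mem[OF Suc.prems] Suc.prems ab h by simp
        moreover have "d (\<gamma> s) ?b \<le> d (\<gamma> s) ?a + d ?a ?b"
          using mem[of 0] mem[of i] mem[OF Suc.prems] Suc.prems by (intro triangle) auto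
        ultimately show ?case using Suc by (simp add: algebra_simps)
      qed
      from this[of n] show ?case
        using step_cubes[of n l \<kappa>] elim by (simp add: h_def l_def)
    qed
    then have "d (\<gamma> s) (\<gamma> t) \<le> l"
      by (rule tendsto_lowerbound[OF cubic_error_tendsto]) simp
    then show ?thesis by (simp add: l_def)
  qed
  have "d (\<gamma> s) (\<gamma> t) = t - s" if st: "0 \<le> s" "s \<le> t" "t \<le> d x y" for s t
  proof -
    have m: "\<gamma> s \<in> K" "\<gamma> t \<in> K" using K st by (auto simp: image_subset_iff)
    have "d x y \<le> d x (\<gamma> s) + d (\<gamma> s) (\<gamma> t) + d (\<gamma> t) y"
      using triangle[OF assms(1) m(1) assms(2)] triangle[OF m assms(2)] by linarith
    then show ?thesis using le[OF st] le[of 0 s] le[of t "d x y"] assms(3,4) st by simp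
  qed
  then show ?thesis using assms unfolding geodesic_def by auto
qed

text \<open>Being a geodesic amounts to inequalities between the values at two times each. Finitely many of them are met by choosing
intermediate points one after the other, from \<open>x\<close> towards \<open>y\<close>; all of them together by compactness of the
product of copies of \<open>K\<close>, one for each time.\<close>

lemma geodesic_exists:
  assumes between: "\<And>x y a. x \<in> K \<Longrightarrow> y \<in> K \<Longrightarrow> 0 \<le> a \<Longrightarrow> a \<le> d x y \<Longrightarrow> \<exists>p\<in>K. d x p = a \<and> d p y = d x y - a"
    and x: "x \<in> K" and y: "y \<in> K"
  shows "\<exists>\<gamma>. geodesic x y \<gamma>"
proof -
  define L where "L = d x y"
  have L: "0 \<le> L" using nonneg x y by (simp add: L_def)
  have fin: "\<exists>f. f 0 = x \<and> (\<forall>t\<in>insert 0 T. f t \<in> K \<and> d (f t) y = L - t) \<and>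
      (\<forall>s\<in>insert 0 T. \<forall>t\<in>insert 0 T. s \<le> t \<longrightarrow> d (f s) (f t) \<le> t - s)"
    if "finite T" "T \<subseteq> {0..L}" for T :: "real set"
    using that
  proof (induction T rule: finite_linorder_max_induct)
    case empty
    show ?case by (rule exI[of _ "\<lambda>_. x"]) (use x y in \<open>auto simp: L_def\<close>)
  next
    case (insert b A)
    then obtain f where f: "f 0 = x" "\<forall>t\<in>insert 0 A. f t \<in> K \<and> d (f t) y = L - t"
      "\<forall>s\<in>insert 0 A. \<forall>t\<in>insert 0 A. s \<le> t \<longrightarrow> d (f s) (f t) \<le> t - s" by auto
    show ?case
    proof (cases "b = 0")
      case True
      then show ?thesis using f by (intro exI[of _ f]) simp
    next
      case False
      \<comment> \<open>the new point is chosen between the last point so far, at time \<open>a\<close>, and \<open>y\<close>\<close>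
      define a where "a = Max (insert 0 A)"
      have a: "a \<in> insert 0 A" unfolding a_def using insert by (intro Max_in) auto
      have a_ge: "s \<le> a" if "s \<in> insert 0 A" for s unfolding a_def using insert that by (intro Max_ge) auto
      have ab: "a < b" using a insert False by auto
      have b: "0 < b" "b \<le> L" using insert False by auto
      obtain p where p: "p \<in> K" "d (f a) p = b - a" "d p y = L - b"
        using between[of "f a" y "b - a"] f(2) a ab b y by auto
      have new: "d (f s) p \<le> b - s" if "s \<in> insert 0 A" for s
      proof -
        have "f s \<in> K" "f a \<in> K" using f(2) a that by auto
        then have "d (f s) p \<le> d (f s) (f a) + d (f a) p" using p by (intro triangle) auto
        moreover have "d (f s) (f a) \<le> a - s" using f(3) a a_ge that by blast
        ultimately show ?thesis using p by simp
      qed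
      have lt: "s < b" if "s \<in> insert 0 A" for s using that insert b by auto
      show ?thesis
      proof (intro exI[of _ "f(b := p)"] conjI ballI impI)
        show "(f(b := p)) 0 = x" using False f by simp
        fix t assume t: "t \<in> insert 0 (insert b A)"
        show "(f(b := p)) t \<in> K" "d ((f(b := p)) t) y = L - t" using t f p by auto
        fix u assume u: "u \<in> insert 0 (insert b A)" "t \<le> u"
        show "d ((f(b := p)) t) ((f(b := p)) u) \<le> u - t"
          using t u f(3) new lt p by (cases "t = b"; cases "u = b") force+
      qed
    qed
  qed
  define X where "X = {f :: real \<Rightarrow> 'a. \<forall>t. f t \<in> K}"
  define C where "C = (\<lambda>(s, t). {f :: real \<Rightarrow> 'a. f 0 = x \<and> f L = y \<and> (f s, f t) \<in> {z \<in> K \<times> K. (case z of (p, q) \<Rightarrow> d p q) \<le> t - s}})"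
  define I where "I = {(s, t). 0 \<le> s \<and> s \<le> t \<and> t \<le> L}"
  have "X \<inter> (\<Inter>i\<in>I. C i) \<noteq> {}"
  proof (rule compact_imp_fip_image)
    have "compactin (product_topology (\<lambda>_. euclidean) UNIV) (PiE (UNIV :: real set) (\<lambda>_. K))"
      unfolding compactin_PiE using compact by simp
    moreover have "PiE UNIV (\<lambda>_. K) = X" by (auto simp: X_def PiE_def)
    ultimately show "compact X" by (simp add: euclidean_product_topology)
    fix i assume "i \<in> I"
    obtain s t where i: "i = (s, t)" by force
    have "closed {z \<in> K \<times> K. (case z of (p, q) \<Rightarrow> d p q) \<le> t - s}"
      using continuous_closed_preimage[OF continuous_on_d, of "{..t - s}"] compact
      by (simp add: closed_Times compact_imp_closed vimage_def Int_def conj_commute)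
    then have "closed ((\<lambda>f :: real \<Rightarrow> 'a. (f s, f t)) -` {z \<in> K \<times> K. (case z of (p, q) \<Rightarrow> d p q) \<le> t - s})"
      by (intro closed_vimage continuous_on_Pair continuous_on_product_coordinates)
    then show "closed (C i)" unfolding C_def i prod.case vimage_def
      by (intro closed_Collect_conj closed_Collect_eq continuous_on_product_coordinates continuous_on_const) auto
  next
    fix J assume J: "finite J" "J \<subseteq> I"
    define T where "T = insert L (fst ` J \<union> snd ` J)"
    have "finite T" "T \<subseteq> {0..L}" using J L by (auto simp: T_def I_def)
    from fin[OF this] obtain f where f: "f 0 = x" "\<forall>t\<in>insert 0 T. f t \<in> K \<and> d (f t) y = L - t"
      "\<forall>s\<in>insert 0 T. \<forall>t\<in>insert 0 T. s \<le> t \<longrightarrow> d (f s) (f t) \<le> t - s" by blast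
    define f' where "f' t = (if t \<in> insert 0 T then f t else x)" for t
    have "f L = y" using f(2) y by (intro eq_0D) (auto simp: T_def)
    then have "f' \<in> X" "f' 0 = x" "f' L = y" using f x by (auto simp: f'_def X_def T_def)
    moreover have "f' \<in> C (s, t)" if "(s, t) \<in> J" for s t
    proof -
      have "s \<in> T" "t \<in> T" "s \<le> t" using that J by (force simp: T_def I_def)+
      then show ?thesis using f calculation by (auto simp: C_def f'_def)
    qed
    ultimately show "X \<inter> (\<Inter>i\<in>J. C i) \<noteq> {}" by auto
  qed
  then obtain \<gamma> where \<gamma>: "\<gamma> \<in> X" "\<And>s t. 0 \<le> s \<Longrightarrow> s \<le> t \<Longrightarrow> t \<le> L \<Longrightarrow> \<gamma> \<in> C (s, t)"
    unfolding I_def by auto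
  have ends: "\<gamma> 0 = x" "\<gamma> L = y" using \<gamma>(2)[of 0 L] L by (auto simp: C_def)
  have le: "d (\<gamma> s) (\<gamma> t) \<le> t - s" if "0 \<le> s" "s \<le> t" "t \<le> L" for s t
    using \<gamma>(2)[OF that] by (auto simp: C_def)
  have "d (\<gamma> s) (\<gamma> t) = t - s" if st: "0 \<le> s" "s \<le> t" "t \<le> L" for s t
  proof -
    have m: "\<gamma> s \<in> K" "\<gamma> t \<in> K" using \<gamma>(1) by (auto simp: X_def)
    have "L \<le> d x (\<gamma> s) + d (\<gamma> s) (\<gamma> t) + d (\<gamma> t) y"
      using triangle[OF x m(1) y] triangle[OF m y] unfolding L_def by linarith
    then show ?thesis using le[OF st] le[of 0 s] le[of t L] ends st by simp
  qed
  then have "geodesic x y \<gamma>"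
    using ends \<gamma>(1) unfolding geodesic_def L_def[symmetric] X_def by auto
  then show ?thesis by blast
qed

end

section \<open>Initial velocities and the first variation\<close>

text \<open>Stewart's theorem for the triangle with sides \<open>x\<close>, \<open>y\<close> and \<open>x + y\<close>; the parallelogram law is the case \<open>s = t\<close>.\<close>

lemma stewart_identity:
  fixes x y :: "'a::real_inner" and s t :: real
  shows "(norm (t *\<^sub>R x - s *\<^sub>R y))\<^sup>2 = (s + t) * (t * (norm x)\<^sup>2 + s * (norm y)\<^sup>2) - s * t * (norm (x + y))\<^sup>2"
  unfolding norm_sq_add norm_sq_diff
  by (simp add: power_mult_distrib power2_eq_square[of s] power2_eq_square[of t] algebra_simps)

text \<open>The rate is that of the first variation, where the remainder has order \<open>3/2\<close>.\<close>

lemma has_derivative_within_of_bound: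
  fixes f :: "'a::real_normed_vector \<Rightarrow> 'b::real_normed_vector"
  assumes "bounded_linear F" "0 < e"
    and bound: "\<And>u. u \<in> S \<Longrightarrow> norm (u - x) < e \<Longrightarrow> norm (f u - f x - F (u - x)) \<le> C * sqrt (norm (u - x)) * norm (u - x)"
  shows "(f has_derivative F) (at x within S)"
  unfolding has_derivative_within
proof (intro conjI assms(1), rule Lim_null_comparison)
  have lim: "((\<lambda>u. norm (u - x)) \<longlongrightarrow> norm (x - x)) (at x within S)"
    by (intro tendsto_intros)
  have "((\<lambda>u. C * sqrt (norm (u - x))) \<longlongrightarrow> C * sqrt (norm (x - x))) (at x within S)"
    by (intro tendsto_intros)
  then show "((\<lambda>u. C * sqrt (norm (u - x))) \<longlongrightarrow> 0) (at x within S)" by simp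
  have "\<forall>\<^sub>F u in at x within S. norm (u - x) < e" using order_tendstoD(2)[OF lim, of e] assms by simp
  moreover have "\<forall>\<^sub>F u in at x within S. u \<in> S \<and> u \<noteq> x" by (auto simp: eventually_at_filter)
  ultimately show "\<forall>\<^sub>F u in at x within S. norm ((1 / norm (u - x)) *\<^sub>R (f u - (f x + F (u - x)))) \<le> C * sqrt (norm (u - x))"
  proof eventually_elim
    case (elim u)
    then show ?case using bound[of u] by (simp add: divide_le_eq diff_diff_eq)
  qed
qed

context cubic_metric
begin

definition velocity_error :: real where "velocity_error = 2 * sqrt (2 * \<kappa>)"

lemma velocity_error_nonneg: "0 \<le> velocity_error" using \<kappa>_nonneg by (simp add: velocity_error_def)

text \<open>For \<open>t/2 \<le> s \<le> t\<close> put \<open>X = \<gamma>(s) - x\<close> and \<open>Y = \<gamma>(t) - \<gamma>(s)\<close>. Then \<open>|X| \<le> s\<close> and \<open>|Y| \<le> t - s\<close>, while \<open>|X + Y|\<close> falls short of \<open>t\<close>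
by a cubic amount only. By Stewart's theorem \<open>X\<close> and \<open>Y\<close> are almost parallel, and the difference quotients at \<open>s\<close> and \<open>t\<close>
differ by at most \<open>A t\<close> with \<open>A = (2 \<kappa>)\<^sup>1\<^sup>/\<^sup>2\<close>. Halving \<open>t\<close> repeatedly gives \<open>2 A t\<close> for all \<open>s \<le> t\<close>, so the difference quotients
converge as \<open>t\<close> tends to \<open>0\<close>.\<close>

lemma geodesic_velocity:
  assumes \<gamma>: "geodesic x y \<gamma>" and K: "x \<in> K" "y \<in> K" and xy: "x \<noteq> y"
  obtains v where "norm v = 1"
    "\<And>t. 0 \<le> t \<Longrightarrow> t \<le> d x y \<Longrightarrow> t \<le> \<rho> \<Longrightarrow> norm (\<gamma> t - x - t *\<^sub>R v) \<le> velocity_error * t\<^sup>2"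
proof -
  define b where "b = min \<rho> (d x y)"
  have "0 < d x y" using nonneg[OF K] eq_0D[OF K] xy by fastforce
  then have b: "0 < b" using \<rho>_pos by (simp add: b_def)
  define A where "A = sqrt (2 * \<kappa>)"
  have A: "0 \<le> A" "velocity_error = 2 * A" using \<kappa>_nonneg by (auto simp: A_def velocity_error_def)
  have \<gamma>0: "\<gamma> 0 = x" using \<gamma> by (simp add: geodesic_def)
  define q where "q t = (1 / t) *\<^sub>R (\<gamma> t - x)" for t
  have half: "norm (q s - q t) \<le> A * t" if st: "0 < s" "s \<le> t" "t \<le> 2 * s" "t \<le> b" for s t
  proof -
    define X where "X = \<gamma> s - x"
    define Y where "Y = \<gamma> t - \<gamma> s"
    have "dist (\<gamma> 0) (\<gamma> s) \<le> s - 0" "dist (\<gamma> s) (\<gamma> t) \<le> t - s"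
      by (rule geodesic_dist_ge(2)[OF \<gamma>]; use st b_def in simp)+
    then have XY: "norm X \<le> s" "norm Y \<le> t - s" by (auto simp: X_def Y_def \<gamma>0 dist_norm norm_minus_commute)
    then have XY2: "(norm X)\<^sup>2 \<le> s\<^sup>2" "(norm Y)\<^sup>2 \<le> (t - s)\<^sup>2" by (intro power_mono; simp)+
    have "t - \<kappa> * t ^ 3 \<le> norm (X + Y)"
      using geodesic_dist_ge(1)[OF \<gamma>, of 0 t] st by (simp add: b_def X_def Y_def \<gamma>0 dist_norm norm_minus_commute)
    have "t\<^sup>2 - 2 * \<kappa> * t ^ 4 \<le> (norm (X + Y))\<^sup>2"
    proof (cases "0 \<le> t - \<kappa> * t ^ 3")
      case True
      then have "(t - \<kappa> * t ^ 3)\<^sup>2 \<le> (norm (X + Y))\<^sup>2"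
        using \<open>t - \<kappa> * t ^ 3 \<le> norm (X + Y)\<close> by (intro power_mono)
      moreover have "(t - \<kappa> * t ^ 3)\<^sup>2 = t\<^sup>2 - 2 * \<kappa> * t ^ 4 + (\<kappa> * t ^ 3)\<^sup>2"
        unfolding power2_diff by (simp add: power_numeral_reduce)
      ultimately show ?thesis using zero_le_power2[of "\<kappa> * t ^ 3"] by linarith
    next
      case False
      then have "t * t \<le> t * (\<kappa> * t ^ 3)" using st by (intro mult_left_mono) auto
      moreover have "t * (\<kappa> * t ^ 3) = \<kappa> * t ^ 4" by (simp add: power_numeral_reduce)
      moreover have "0 \<le> \<kappa> * t ^ 4" using \<kappa>_nonneg by simp
      ultimately have "t\<^sup>2 - 2 * \<kappa> * t ^ 4 \<le> 0" by (simp add: power2_eq_square)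
      then show ?thesis using zero_le_power2[of "norm (X + Y)"] by linarith
    qed
    then have lower: "s * (t - s) * (t\<^sup>2 - 2 * \<kappa> * t ^ 4) \<le> s * (t - s) * (norm (X + Y))\<^sup>2"
      using st by (intro mult_left_mono) auto
    have "(norm ((t - s) *\<^sub>R X - s *\<^sub>R Y))\<^sup>2
        = t * ((t - s) * (norm X)\<^sup>2 + s * (norm Y)\<^sup>2) - s * (t - s) * (norm (X + Y))\<^sup>2"
      using stewart_identity[of "t - s" X s Y] by simp
    also have "\<dots> \<le> t * ((t - s) * s\<^sup>2 + s * (t - s)\<^sup>2) - s * (t - s) * (t\<^sup>2 - 2 * \<kappa> * t ^ 4)"
    proof -
      have "t * ((t - s) * (norm X)\<^sup>2 + s * (norm Y)\<^sup>2) \<le> t * ((t - s) * s\<^sup>2 + s * (t - s)\<^sup>2)"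
        using XY2 st by (intro mult_left_mono add_mono) auto
      then show ?thesis using lower by linarith
    qed
    also have "\<dots> = 2 * \<kappa> * t ^ 4 * (s * (t - s))"
      by (simp add: power_numeral_reduce algebra_simps)
    also have "\<dots> \<le> 2 * \<kappa> * t ^ 4 * (s * s)"
      using st \<kappa>_nonneg by (intro mult_left_mono) auto
    also have "\<dots> = (A * t\<^sup>2 * s)\<^sup>2"
      using \<kappa>_nonneg by (simp add: A_def power_mult_distrib power2_eq_square[of s] flip: power_mult)
    finally have le: "norm ((t - s) *\<^sub>R X - s *\<^sub>R Y) \<le> A * t\<^sup>2 * s"
      by (rule power2_le_imp_le) (use A st in auto)
    have "q s - q t = (1 / (s * t)) *\<^sub>R ((t - s) *\<^sub>R X - s *\<^sub>R Y)"
    proof -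
      have "(t - s) *\<^sub>R X - s *\<^sub>R Y = t *\<^sub>R X - s *\<^sub>R (X + Y)" by (simp add: algebra_simps)
      then have "(1 / (s * t)) *\<^sub>R ((t - s) *\<^sub>R X - s *\<^sub>R Y) = (1 / s) *\<^sub>R X - (1 / t) *\<^sub>R (X + Y)"
        using st by (simp add: scaleR_diff_right)
      then show ?thesis by (simp add: q_def X_def Y_def)
    qed
    then have "norm (q s - q t) = (1 / (s * t)) * norm ((t - s) *\<^sub>R X - s *\<^sub>R Y)" using st by simp
    also have "\<dots> \<le> (1 / (s * t)) * (A * t\<^sup>2 * s)" using le st by (intro mult_left_mono) auto
    also have "\<dots> = A * t" using st by (simp add: power2_eq_square)
    finally show ?thesis .
  qed
  have chain: "norm (q s - q t) \<le> velocity_error * t" if "0 < s" "s \<le> t" "t \<le> b" "t \<le> 2 ^ n * s" for s t n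
    using that
  proof (induction n arbitrary: t)
    case 0
    then show ?case using A velocity_error_nonneg by simp
  next
    case (Suc n)
    show ?case
    proof (cases "t \<le> 2 * s")
      case True
      then have "norm (q s - q t) \<le> A * t" using half Suc.prems by simp
      moreover have "0 \<le> A * t" using A Suc.prems by simp
      ultimately show ?thesis using A by simp
    next
      case False
      have "norm (q s - q (t / 2)) \<le> velocity_error * (t / 2)" by (rule Suc.IH) (use False Suc.prems in auto)
      moreover have "norm (q (t / 2) - q t) \<le> A * t" by (rule half) (use Suc.prems in auto)
      ultimately show ?thesis using norm_triangle_ineq[of "q s - q (t / 2)" "q (t / 2) - q t"] A by simp
    qed
  qed
  have quot: "norm (q s - q t) \<le> velocity_error * t" if st: "0 < s" "s \<le> t" "t \<le> b" for s t
  proof -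
    obtain n where "t / s < 2 ^ n" using real_arch_pow[of 2 "t / s"] by auto
    then show ?thesis using chain[OF st, of n] st by (simp add: field_simps)
  qed
  define r where "r n = q (b / real (Suc n))" for n
  have r_le: "norm (r n - r m) \<le> velocity_error * b * (1 / real (Suc m))" if "m \<le> n" for m n
  proof -
    have "b / real (Suc n) \<le> b / real (Suc m)" using that b by (intro divide_left_mono) auto
    moreover have "b / real (Suc m) \<le> b" using b by (simp add: divide_le_eq)
    ultimately show ?thesis using quot[of "b / real (Suc n)" "b / real (Suc m)"] b by (simp add: r_def)
  qed
  have null: "(\<lambda>m. velocity_error * b * (1 / real (Suc m))) \<longlonglongrightarrow> velocity_error * b * 0"
    by (intro tendsto_intros LIMSEQ_Suc[OF lim_1_over_n])
  have "Cauchy r"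
  proof (rule metric_CauchyI)
    fix e :: real assume "e > 0"
    then obtain M where M: "velocity_error * b * (1 / real (Suc M)) < e / 2"
      using order_tendstoD(2)[OF null, of "e / 2"] by (auto simp: eventually_sequentially)
    show "\<exists>M. \<forall>m\<ge>M. \<forall>n\<ge>M. dist (r m) (r n) < e"
    proof (intro exI allI impI)
      fix m n assume "M \<le> m" "M \<le> n"
      then have "dist (r m) (r M) < e / 2" "dist (r n) (r M) < e / 2"
        using le_less_trans[OF r_le M] by (simp_all only: dist_norm)
      then show "dist (r m) (r n) < e" using dist_triangle2[of "r m" "r n" "r M"] by simp
    qed
  qed
  then obtain v where v: "r \<longlonglongrightarrow> v" using Cauchy_convergent_iff convergent_def by blast
  have lim_le: "norm (v - q t) \<le> velocity_error * t" if t: "0 < t" "t \<le> b" for t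
  proof (rule tendsto_upperbound[OF tendsto_norm[OF tendsto_diff[OF v tendsto_const]]])
    have "(\<lambda>n. b * (1 / real (Suc n))) \<longlonglongrightarrow> b * 0"
      by (intro tendsto_intros LIMSEQ_Suc[OF lim_1_over_n])
    then have "\<forall>\<^sub>F n in sequentially. b * (1 / real (Suc n)) < t"
      using order_tendstoD(2)[of _ "b * 0" sequentially t] t by simp
    then show "\<forall>\<^sub>F n in sequentially. norm (r n - q t) \<le> velocity_error * t"
    proof eventually_elim
      case (elim n)
      then show ?case unfolding r_def using b t by (intro quot) auto
    qed
  qed simp
  have qn: "1 - \<kappa> * t\<^sup>2 \<le> norm (q t)" "norm (q t) \<le> 1" if t: "0 < t" "t \<le> b" for t
  proof -
    have "t - 0 - \<kappa> * (t - 0) ^ 3 \<le> dist (\<gamma> 0) (\<gamma> t)" "dist (\<gamma> 0) (\<gamma> t) \<le> t - 0"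
      by (rule geodesic_dist_ge[OF \<gamma>]; use t b_def in simp)+
    then have "t * (1 - \<kappa> * t\<^sup>2) \<le> norm (\<gamma> t - x)" "norm (\<gamma> t - x) \<le> t"
      by (auto simp: \<gamma>0 dist_norm norm_minus_commute power_numeral_reduce algebra_simps)
    then show "1 - \<kappa> * t\<^sup>2 \<le> norm (q t)" "norm (q t) \<le> 1"
      using t by (auto simp: q_def pos_le_divide_eq mult.commute)
  qed
  have "norm v = 1"
  proof (rule LIMSEQ_unique[OF tendsto_norm[OF v]])
    show "(\<lambda>n. norm (r n)) \<longlonglongrightarrow> 1"
    proof (rule tendsto_sandwich[OF _ _ _ tendsto_const])
      have "(\<lambda>n. 1 - \<kappa> * (b * (1 / real (Suc n)))\<^sup>2) \<longlonglongrightarrow> 1 - \<kappa> * (b * 0)\<^sup>2"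
        by (intro tendsto_intros LIMSEQ_Suc[OF lim_1_over_n])
      then show "(\<lambda>n. 1 - \<kappa> * (b / real (Suc n))\<^sup>2) \<longlonglongrightarrow> 1" by simp
      have "0 < b / real (Suc n) \<and> b / real (Suc n) \<le> b" for n using b by (simp add: divide_le_eq)
      then show "\<forall>\<^sub>F n in sequentially. 1 - \<kappa> * (b / real (Suc n))\<^sup>2 \<le> norm (r n)"
        "\<forall>\<^sub>F n in sequentially. norm (r n) \<le> 1"
        using qn by (auto simp: r_def intro!: always_eventually simp del: of_nat_Suc)
    qed
  qed
  moreover have "norm (\<gamma> t - x - t *\<^sub>R v) \<le> velocity_error * t\<^sup>2" if t: "0 \<le> t" "t \<le> d x y" "t \<le> \<rho>" for t
  proof (cases "t = 0")
    case False
    then have "\<gamma> t - x - t *\<^sub>R v = t *\<^sub>R (q t - v)" by (simp add: q_def scaleR_diff_right)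
    then have "norm (\<gamma> t - x - t *\<^sub>R v) = t * norm (v - q t)" using t by (simp add: norm_minus_commute)
    also have "\<dots> \<le> t * (velocity_error * t)" using lim_le[of t] t False by (intro mult_left_mono) (auto simp: b_def)
    finally show ?thesis by (simp add: power2_eq_square mult.left_commute mult.commute)
  qed (use \<gamma>0 in simp)
  ultimately show ?thesis using that by blast
qed

text \<open>The point \<open>p\<close> is approximately \<open>x + s e\<close>, and \<open>|u - x| = s\<^sup>2\<close>. Expanding the square of \<open>|u - p|\<close> produces the term
\<open>- 2 s \<langle>u - x, e\<rangle>\<close> up to an error of order \<open>s\<^sup>4\<close>. The vector \<open>e\<close> is not required to be the velocity of a geodesic through \<open>p\<close>
exactly, which allows the same estimate to be used in both directions in \<open>first_variation\<close>.\<close>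

lemma first_variation_upper:
  assumes K: "x \<in> K" "u \<in> K" "p \<in> K" and s: "0 < s" "s \<le> 1" "2 * s \<le> \<rho>"
    and xu: "dist x u = s\<^sup>2" and xp: "d x p \<le> s" and e: "norm (p - x - s *\<^sub>R e) \<le> Q * s\<^sup>2"
  shows "d u p \<le> s - (u - x) \<bullet> e + (Q + 1/2 + 8 * \<kappa>) * s ^ 3"
proof -
  define w where "w = u - x"
  have nw: "norm w = s\<^sup>2" using xu by (simp add: w_def dist_norm norm_minus_commute)
  have npx: "norm (p - x) \<le> s" using dist_le[OF K(1,3)] xp by (simp add: dist_norm norm_minus_commute)
  have "\<bar>(p - x - s *\<^sub>R e) \<bullet> w\<bar> \<le> norm (p - x - s *\<^sub>R e) * norm w" by (rule Cauchy_Schwarz_ineq2)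
  also have "\<dots> \<le> Q * s\<^sup>2 * s\<^sup>2" unfolding nw using e by (intro mult_right_mono) auto
  finally have inner: "s * (w \<bullet> e) - Q * s\<^sup>2 * s\<^sup>2 \<le> (p - x) \<bullet> w"
    by (simp add: inner_diff_left[of "p - x"] inner_commute[of e])
  have "dist u p = norm ((p - x) - w)" by (simp add: w_def dist_norm norm_minus_commute)
  then have "(dist u p)\<^sup>2 = (norm (p - x))\<^sup>2 - 2 * ((p - x) \<bullet> w) + (norm w)\<^sup>2" by (simp only: norm_sq_diff)
  also have "\<dots> \<le> s\<^sup>2 - 2 * (s * (w \<bullet> e) - Q * s\<^sup>2 * s\<^sup>2) + (s\<^sup>2)\<^sup>2"
    unfolding nw using npx inner s(1) by (intro add_mono diff_mono mult_left_mono power_mono) auto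
  finally have sq: "(dist u p)\<^sup>2 + s\<^sup>2 \<le> 2 * s * (s - w \<bullet> e + (Q + 1/2) * s ^ 3)"
    by (simp add: power_numeral_reduce algebra_simps)
  \<comment> \<open>the arithmetic-geometric mean inequality linearises the square root without loss at this order\<close>
  have "2 * s * dist u p \<le> (dist u p)\<^sup>2 + s\<^sup>2" using sum_squares_bound[of s "dist u p"] by simp
  with sq have "2 * s * dist u p \<le> 2 * s * (s - w \<bullet> e + (Q + 1/2) * s ^ 3)" by linarith
  then have up: "dist u p \<le> s - w \<bullet> e + (Q + 1/2) * s ^ 3" using s by (simp add: mult_le_cancel_left_pos)
  have "s\<^sup>2 \<le> s" using s by (simp add: power2_eq_square mult_left_le)
  then have "dist u p \<le> 2 * s"
    using dist_triangle3[of u p x] xu npx by (simp add: dist_norm norm_minus_commute)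
  then have "dist u p \<le> \<rho>" and "dist u p ^ 3 \<le> (2 * s) ^ 3" using s(3) power_mono[of "dist u p" "2 * s" 3] by auto
  then have "d u p \<le> dist u p + \<kappa> * (2 * s) ^ 3"
    using le_cubic[OF K(2,3)] mult_left_mono[OF _ \<kappa>_nonneg, of "dist u p ^ 3" "(2 * s) ^ 3"] by linarith
  then show ?thesis using up by (simp add: w_def power_mult_distrib algebra_simps)
qed

text \<open>Approximating the ends of \<open>\<gamma>\<close> from \<open>S\<close> gives, by compactness, some point \<open>p\<close> that satisfies Stewart's inequality
for every \<open>z\<close> in \<open>K\<close>. The choice of \<open>\<gamma>(l d(a, b))\<close> for \<open>z\<close> makes the right-hand side vanish, so \<open>p\<close> is the point in question. In
particular, nothing has to be known about convergence of the approximating geodesics.\<close>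

lemma stewart_from_dense:
  assumes S: "S \<subseteq> K" "K \<subseteq> closure S"
    and ex: "\<And>a b l. a \<in> S \<Longrightarrow> b \<in> S \<Longrightarrow> 0 \<le> l \<Longrightarrow> l \<le> 1 \<Longrightarrow>
       \<exists>m\<in>K. \<forall>z\<in>S. (d z m)\<^sup>2 \<le> (1 - l) * (d z a)\<^sup>2 + l * (d z b)\<^sup>2 - l * (1 - l) * (d a b)\<^sup>2"
    and \<gamma>: "geodesic a b \<gamma>" and K: "a \<in> K" "b \<in> K" "z \<in> K" and l: "0 \<le> l" "l \<le> 1"
  shows "(d z (\<gamma> (l * d a b)))\<^sup>2 \<le> (1 - l) * (d z a)\<^sup>2 + l * (d z b)\<^sup>2 - l * (1 - l) * (d a b)\<^sup>2"
proof -
  have seq: "\<exists>f. (\<forall>n. f n \<in> S) \<and> f \<longlonglongrightarrow> x" if "x \<in> K" for x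
    using that S closure_sequential by blast
  obtain f where f: "\<And>n. f n \<in> S" "f \<longlonglongrightarrow> a" using seq K by blast
  obtain g where g: "\<And>n. g n \<in> S" "g \<longlonglongrightarrow> b" using seq K by blast
  have "\<exists>m\<in>K. \<forall>z\<in>S. (d z m)\<^sup>2 \<le> (1 - l) * (d z (f n))\<^sup>2 + l * (d z (g n))\<^sup>2 - l * (1 - l) * (d (f n) (g n))\<^sup>2" for n
    by (rule ex) (use f g l in auto)
  then obtain m where m: "\<And>n. m n \<in> K"
    "\<And>n z. z \<in> S \<Longrightarrow> (d z (m n))\<^sup>2 \<le> (1 - l) * (d z (f n))\<^sup>2 + l * (d z (g n))\<^sup>2 - l * (1 - l) * (d (f n) (g n))\<^sup>2"
    by metis
  obtain p r where p: "p \<in> K" "strict_mono r" "(m \<circ> r) \<longlonglongrightarrow> p"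
    using compact m(1) unfolding compact_def by metis
  have stew: "(d z p)\<^sup>2 \<le> (1 - l) * (d z a)\<^sup>2 + l * (d z b)\<^sup>2 - l * (1 - l) * (d a b)\<^sup>2" if z: "z \<in> K" for z
  proof -
    obtain h where h: "\<And>n. h n \<in> S" "h \<longlonglongrightarrow> z" using seq z by blast
    have sub: "(\<lambda>n. f (r n)) \<longlonglongrightarrow> a" "(\<lambda>n. g (r n)) \<longlonglongrightarrow> b" "(\<lambda>n. m (r n)) \<longlonglongrightarrow> p"
      using LIMSEQ_subseq_LIMSEQ[OF f(2) p(2)] LIMSEQ_subseq_LIMSEQ[OF g(2) p(2)] p(3) by (auto simp: o_def)
    have inK: "f n \<in> K" "g n \<in> K" "h n \<in> K" for n using f g h S by auto
    show ?thesis
    proof (rule LIMSEQ_le)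
      show "(\<lambda>n. (d (h n) (m (r n)))\<^sup>2) \<longlonglongrightarrow> (d z p)\<^sup>2"
        by (intro tendsto_power tendsto_d h sub always_eventually allI inK m z p)
      show "(\<lambda>n. (1 - l) * (d (h n) (f (r n)))\<^sup>2 + l * (d (h n) (g (r n)))\<^sup>2 - l * (1 - l) * (d (f (r n)) (g (r n)))\<^sup>2)
         \<longlonglongrightarrow> (1 - l) * (d z a)\<^sup>2 + l * (d z b)\<^sup>2 - l * (1 - l) * (d a b)\<^sup>2"
        by (intro tendsto_add tendsto_diff tendsto_mult tendsto_const tendsto_power tendsto_d h sub always_eventually allI inK z K)
      show "\<exists>N. \<forall>n\<ge>N. (d (h n) (m (r n)))\<^sup>2 \<le>
         (1 - l) * (d (h n) (f (r n)))\<^sup>2 + l * (d (h n) (g (r n)))\<^sup>2 - l * (1 - l) * (d (f (r n)) (g (r n)))\<^sup>2"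
        using m(2) h(1) by blast
    qed
  qed
  define L where "L = d a b"
  have lL: "0 \<le> l * L" "l * L \<le> L" using l nonneg[OF K(1,2)] by (auto simp: L_def mult_left_le_one_le)
  have q: "\<gamma> (l * L) \<in> K" using geodesic_mem[OF \<gamma>] lL by (simp add: L_def)
  have "d (\<gamma> (l * L)) a = l * L" "d (\<gamma> (l * L)) b = L - l * L"
    using geodesic_ends[OF \<gamma> K(1,2)] lL sym[OF q K(1)] by (auto simp: L_def)
  then have "(d (\<gamma> (l * L)) p)\<^sup>2 \<le> (1 - l) * (l * L)\<^sup>2 + l * (L - l * L)\<^sup>2 - l * (1 - l) * L\<^sup>2"
    using stew[OF q] by (simp add: L_def)
  also have "\<dots> = 0" by (simp add: power2_eq_square algebra_simps)
  finally have "\<gamma> (l * L) = p" using eq_0D[OF q p(1)] by simp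
  then show ?thesis using stew[OF K(3)] by (simp add: L_def)
qed

end

section \<open>Consequences of the comparison property\<close>

text \<open>The comparison property enters through Stewart's inequality, which is an equality in the Euclidean plane.\<close>

locale cat0_cubic_metric = cubic_metric +
  assumes geodesic_ex: "x \<in> K \<Longrightarrow> y \<in> K \<Longrightarrow> \<exists>\<gamma>. geodesic x y \<gamma>"
    and stewart: "geodesic a b \<gamma> \<Longrightarrow> a \<in> K \<Longrightarrow> b \<in> K \<Longrightarrow> z \<in> K \<Longrightarrow> 0 \<le> l \<Longrightarrow> l \<le> 1 \<Longrightarrow>
      (d z (\<gamma> (l * d a b)))\<^sup>2 \<le> (1 - l) * (d z a)\<^sup>2 + l * (d z b)\<^sup>2 - l * (1 - l) * (d a b)\<^sup>2"
begin

text \<open>Stewart's inequality is applied twice, first to \<open>\<gamma>\<close> and \<open>c\<close> and then to \<open>\<eta>\<close> and the point on \<open>\<gamma>\<close>; everything but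
\<open>(l d(b, c))\<^sup>2\<close> cancels.\<close>

lemma geodesics_from_common_start:
  assumes \<gamma>: "geodesic a b \<gamma>" and \<eta>: "geodesic a c \<eta>" and K: "a \<in> K" "b \<in> K" "c \<in> K" and l: "0 \<le> l" "l \<le> 1"
  shows "d (\<gamma> (l * d a b)) (\<eta> (l * d a c)) \<le> l * d b c"
proof -
  define m where "m = \<gamma> (l * d a b)"
  define n where "n = \<eta> (l * d a c)"
  have lb: "0 \<le> l * d a b" "l * d a b \<le> d a b" "0 \<le> l * d a c" "l * d a c \<le> d a c"
    using l nonneg K by (auto simp: mult_left_le_one_le)
  have mn: "m \<in> K" "n \<in> K" unfolding m_def n_def using geodesic_mem[OF \<gamma>] geodesic_mem[OF \<eta>] lb by auto
  have ma: "d m a = l * d a b" using geodesic_ends(1)[OF \<gamma> K(1,2)] lb sym[OF mn(1) K(1)] by (simp add: m_def)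
  have 1: "(d m c)\<^sup>2 \<le> (1 - l) * (d a c)\<^sup>2 + l * (d b c)\<^sup>2 - l * (1 - l) * (d a b)\<^sup>2"
    using stewart[OF \<gamma> K l] sym mn K by (simp add: m_def)
  have "(d m n)\<^sup>2 \<le> (1 - l) * (l * d a b)\<^sup>2 + l * (d m c)\<^sup>2 - l * (1 - l) * (d a c)\<^sup>2"
    using stewart[OF \<eta> K(1,3) mn(1) l] by (simp add: n_def ma)
  also have "\<dots> \<le> (1 - l) * (l * d a b)\<^sup>2 + l * ((1 - l) * (d a c)\<^sup>2 + l * (d b c)\<^sup>2 - l * (1 - l) * (d a b)\<^sup>2) - l * (1 - l) * (d a c)\<^sup>2"
    using mult_left_mono[OF 1 l(1)] by simp
  also have "\<dots> = (l * d b c)\<^sup>2" by (simp add: power2_eq_square algebra_simps)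
  finally show ?thesis unfolding m_def[symmetric] n_def[symmetric]
    by (rule power2_le_imp_le) (use l nonneg K in auto)
qed

lemma geodesic_unique:
  assumes "geodesic a b \<gamma>" "geodesic a b \<eta>" "a \<in> K" "b \<in> K" "0 \<le> s" "s \<le> d a b"
  shows "\<gamma> s = \<eta> s"
proof (cases "d a b = 0")
  case True
  then show ?thesis using assms by (simp add: geodesic_def)
next
  case False
  then have "d (\<gamma> s) (\<eta> s) \<le> 0"
    using geodesics_from_common_start[OF assms(1,2,3,4,4), of "s / d a b"] assms by simp
  then show ?thesis using geodesic_mem[OF assms(1)] geodesic_mem[OF assms(2)] assms by (intro eq_0D) auto
qed

text \<open>In contrast to \<open>geodesics_from_common_start\<close> the two points have the same distance from \<open>a\<close>, rather than the same
relative position; this costs a factor \<open>2\<close>.\<close>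

lemma geodesics_diverge_slowly:
  assumes \<gamma>: "geodesic a b \<gamma>" and \<eta>: "geodesic a c \<eta>" and K: "a \<in> K" "b \<in> K" "c \<in> K"
    and s: "0 \<le> s" "s \<le> d a b" "s \<le> d a c" and ab: "0 < d a b"
  shows "d (\<gamma> s) (\<eta> s) \<le> 2 * (s / d a b) * d b c"
proof -
  define l where "l = s / d a b"
  have l: "0 \<le> l" "l \<le> 1" "l * d a b = s" using s ab by (auto simp: l_def)
  have lc: "0 \<le> l * d a c" "l * d a c \<le> d a c" using l nonneg K by (auto simp: mult_left_le_one_le)
  have mem: "\<gamma> s \<in> K" "\<eta> s \<in> K" "\<eta> (l * d a c) \<in> K"
    using geodesic_mem[OF \<gamma>] geodesic_mem[OF \<eta>] s lc by auto
  have "d (\<eta> (l * d a c)) (\<eta> s) = \<bar>l * d a c - s\<bar>"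
    using geodesic_d[OF \<eta>, of "l * d a c" s] geodesic_d[OF \<eta>, of s "l * d a c"] sym[OF mem(2,3)] s lc by linarith
  also have "l * d a c - s = l * (d a c - d a b)" using l(3) by (simp add: right_diff_distrib)
  also have "\<bar>l * (d a c - d a b)\<bar> = l * \<bar>d a c - d a b\<bar>" using l(1) by (simp only: abs_mult abs_of_nonneg)
  also have "\<dots> \<le> l * d b c"
    using triangle[of a b c] triangle[of a c b] sym[of b c] K l by (intro mult_left_mono) auto
  finally have "d (\<gamma> s) (\<eta> s) \<le> l * d b c + l * d b c"
    using geodesics_from_common_start[OF \<gamma> \<eta> K l(1,2)] triangle[OF mem(1,3,2)] unfolding l(3) by linarith
  then show ?thesis by (simp add: l_def)
qed

text \<open>Obtained from \<open>geodesics_from_common_start\<close> by reversing both geodesics, again after a change of parameter.\<close>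

lemma geodesics_to_common_end:
  assumes \<gamma>: "geodesic b a \<gamma>" and \<eta>: "geodesic c a \<eta>" and K: "a \<in> K" "b \<in> K" "c \<in> K"
    and s: "0 \<le> s" "s \<le> d b a" "s \<le> d c a" and ab: "0 < d b a"
  shows "d (\<gamma> s) (\<eta> s) \<le> 2 * d b c"
proof -
  define l where "l = s / d b a"
  have l: "0 \<le> l" "l \<le> 1" "l * d b a = s" using s ab by (auto simp: l_def)
  have lc: "0 \<le> l * d c a" "l * d c a \<le> d c a" using l nonneg K by (auto simp: mult_left_le_one_le)
  have mem: "\<gamma> s \<in> K" "\<eta> s \<in> K" "\<eta> (l * d c a) \<in> K"
    using geodesic_mem[OF \<gamma>] geodesic_mem[OF \<eta>] s lc by auto
  have "d (\<eta> (l * d c a)) (\<eta> s) = \<bar>l * d c a - s\<bar>"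
    using geodesic_d[OF \<eta>, of "l * d c a" s] geodesic_d[OF \<eta>, of s "l * d c a"] sym[OF mem(2,3)] s lc by linarith
  also have "l * d c a - s = l * (d c a - d b a)" using l(3) by (simp add: right_diff_distrib)
  also have "\<bar>l * (d c a - d b a)\<bar> = l * \<bar>d c a - d b a\<bar>" using l(1) by (simp only: abs_mult abs_of_nonneg)
  also have "\<dots> \<le> 1 * d b c"
    using triangle[of b c a] triangle[of c b a] sym[of b c] K l nonneg by (intro mult_mono) auto
  finally have 1: "d (\<eta> (l * d c a)) (\<eta> s) \<le> d b c" by simp
  have "d (\<gamma> (d b a - (1 - l) * d a b)) (\<eta> (d c a - (1 - l) * d a c)) \<le> (1 - l) * d b c"
    using geodesics_from_common_start[OF geodesic_reverse[OF \<gamma> K(2,1)] geodesic_reverse[OF \<eta> K(3,1)] K, of "1 - l"] l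
    by simp
  moreover have "d b a - (1 - l) * d a b = s" "d c a - (1 - l) * d a c = l * d c a"
    using l(3) sym[of a b] sym[of a c] K by (auto simp: algebra_simps)
  moreover have "(1 - l) * d b c \<le> 1 * d b c" using l nonneg K by (intro mult_right_mono) auto
  ultimately have "d (\<gamma> s) (\<eta> (l * d c a)) \<le> d b c" by simp
  then show ?thesis using triangle[OF mem(1,3,2)] 1 by simp
qed

text \<open>This agrees with \<^const>\<open>init_dir\<close> once \<open>d\<close> is the intrinsic metric of a domain.\<close>

definition direction :: "'a \<Rightarrow> 'a \<Rightarrow> 'a" where
  "direction x y = (THE v. norm v = 1 \<and>
     (\<exists>\<gamma>. geodesic x y \<gamma> \<and> (\<gamma> has_vector_derivative v) (at 0 within {0..d x y})))"

lemma direction: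
  assumes \<gamma>: "geodesic x y \<gamma>" and K: "x \<in> K" "y \<in> K" and xy: "x \<noteq> y"
  shows "norm (direction x y) = 1"
    "0 \<le> t \<Longrightarrow> t \<le> d x y \<Longrightarrow> t \<le> \<rho> \<Longrightarrow> norm (\<gamma> t - x - t *\<^sub>R direction x y) \<le> velocity_error * t\<^sup>2"
proof -
  obtain v where v: "norm v = 1"
    "\<And>t. 0 \<le> t \<Longrightarrow> t \<le> d x y \<Longrightarrow> t \<le> \<rho> \<Longrightarrow> norm (\<gamma> t - x - t *\<^sub>R v) \<le> velocity_error * t\<^sup>2"
    by (rule geodesic_velocity[OF \<gamma> K xy]) (rule that)
  have L: "0 < d x y" using nonneg[OF K] eq_0D[OF K] xy by fastforce
  have \<gamma>0: "\<gamma> 0 = x" using \<gamma> by (simp add: geodesic_def)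
  have der: "(\<gamma> has_vector_derivative v) (at 0 within {0..d x y})"
    unfolding has_vector_derivative_def
  proof (rule has_derivative_within_of_bound[where e = "min \<rho> 1" and C = velocity_error])
    show "bounded_linear (\<lambda>h. h *\<^sub>R v)" by (rule bounded_linear_scaleR_left)
    fix t assume t: "t \<in> {0..d x y}" "norm (t - 0) < min \<rho> 1"
    have "sqrt t * sqrt t \<le> 1 * sqrt t" using t by (intro mult_right_mono) auto
    then have "t \<le> sqrt t" using t by simp
    then have "velocity_error * (t * t) \<le> velocity_error * (sqrt t * t)" using t velocity_error_nonneg by (intro mult_left_mono mult_right_mono) auto
    then show "norm (\<gamma> t - \<gamma> 0 - (t - 0) *\<^sub>R v) \<le> velocity_error * sqrt (norm (t - 0)) * norm (t - 0)"
      using v(2)[of t] t by (simp add: \<gamma>0 power2_eq_square mult.assoc)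
  qed (use \<rho>_pos in auto)
  have "direction x y = v"
    unfolding direction_def
  proof (rule the_equality)
    show "norm v = 1 \<and> (\<exists>\<gamma>. geodesic x y \<gamma> \<and> (\<gamma> has_vector_derivative v) (at 0 within {0..d x y}))"
      using v \<gamma> der by blast
    fix v' assume "norm v' = 1 \<and> (\<exists>\<gamma>. geodesic x y \<gamma> \<and> (\<gamma> has_vector_derivative v') (at 0 within {0..d x y}))"
    then obtain \<eta> where \<eta>: "geodesic x y \<eta>" "(\<eta> has_vector_derivative v') (at 0 within {0..d x y})" by blast
    have "(\<gamma> has_vector_derivative v') (at 0 within {0..d x y})"
      by (rule has_vector_derivative_transform[OF _ _ \<eta>(2)]) (use L geodesic_unique[OF \<gamma> \<eta>(1) K] in auto)
    moreover have "at 0 within {0..d x y} \<noteq> bot" using L by (simp add: at_within_Icc_at_right)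
    ultimately show "v' = v" using der vector_derivative_unique_within by blast
  qed
  then show "norm (direction x y) = 1"
    "0 \<le> t \<Longrightarrow> t \<le> d x y \<Longrightarrow> t \<le> \<rho> \<Longrightarrow> norm (\<gamma> t - x - t *\<^sub>R direction x y) \<le> velocity_error * t\<^sup>2"
    using v by auto
qed

text \<open>At time \<open>s\<close> the two geodesics are at distance at most \<open>2 s d(y, z) / d(x, y)\<close>. Division by \<open>s\<close> gives the claim up to the
errors of the two velocities, which are of order \<open>s\<close>.\<close>

lemma direction_Lipschitz:
  assumes K: "x \<in> K" "y \<in> K" "z \<in> K" and ne: "x \<noteq> y" "x \<noteq> z"
  shows "norm (direction x y - direction x z) \<le> 2 * d y z / d x y"
proof (rule field_le_epsilon)
  fix e :: real assume e: "e > 0"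
  obtain \<gamma> \<eta> where \<gamma>: "geodesic x y \<gamma>" and \<eta>: "geodesic x z \<eta>" using geodesic_ex K by metis
  have L: "0 < d x y" "0 < d x z" using nonneg eq_0D K ne by fastforce+
  define s where "s = Min {e / (2 * (velocity_error + 1)), \<rho>, d x y, d x z}"
  have s: "0 < s" "s \<le> \<rho>" "s \<le> d x y" "s \<le> d x z" "s \<le> e / (2 * (velocity_error + 1))"
    using e L \<rho>_pos velocity_error_nonneg by (auto simp: s_def)
  have "2 * velocity_error * s \<le> 2 * (velocity_error + 1) * s" using s by simp
  also have "\<dots> \<le> e" using s(5) velocity_error_nonneg by (simp add: pos_le_divide_eq mult.commute)
  finally have se: "2 * velocity_error * s \<le> e" .
  define v where "v = direction x y"
  define w where "w = direction x z"
  have mem: "\<gamma> s \<in> K" "\<eta> s \<in> K" using geodesic_mem[OF \<gamma>] geodesic_mem[OF \<eta>] s by auto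
  have "s *\<^sub>R (v - w) = (\<gamma> s - \<eta> s) - (\<gamma> s - x - s *\<^sub>R v) + (\<eta> s - x - s *\<^sub>R w)" by (simp add: algebra_simps)
  then have "norm (s *\<^sub>R (v - w)) \<le> norm (\<gamma> s - \<eta> s) + norm (\<gamma> s - x - s *\<^sub>R v) + norm (\<eta> s - x - s *\<^sub>R w)"
    by (metis norm_triangle_ineq4 norm_triangle_le add_mono_thms_linordered_semiring(3))
  also have "norm (\<gamma> s - \<eta> s) \<le> 2 * (s / d x y) * d y z"
    using dist_le[OF mem] geodesics_diverge_slowly[OF \<gamma> \<eta> K _ s(3,4) L(1)] s by (simp add: dist_norm)
  also have "norm (\<gamma> s - x - s *\<^sub>R v) \<le> velocity_error * s\<^sup>2" unfolding v_def using s by (intro direction(2)[OF \<gamma> K(1,2) ne(1)]) auto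
  also have "norm (\<eta> s - x - s *\<^sub>R w) \<le> velocity_error * s\<^sup>2" unfolding w_def using s by (intro direction(2)[OF \<eta> K(1,3) ne(2)]) auto
  also have "norm (s *\<^sub>R (v - w)) = s * norm (v - w)" using s by (simp only: norm_scaleR abs_of_pos)
  finally have "s * norm (v - w) \<le> s * (2 * d y z / d x y + 2 * velocity_error * s)"
    by (simp add: power2_eq_square algebra_simps)
  then have "norm (v - w) \<le> 2 * d y z / d x y + 2 * velocity_error * s" using s by (simp add: mult_le_cancel_left_pos)
  then show "norm (direction x y - direction x z) \<le> 2 * d y z / d x y + e" using se by (simp add: v_def w_def)
qed

definition variation_const :: real where
  "variation_const = (2 * (1 + \<kappa>) + velocity_error + 1) + 1/2 + 8 * \<kappa>"

text \<open>Both inequalities are instances of \<open>first_variation_upper\<close>: for the upper bound \<open>p\<close> lies on the geodesic from \<open>x\<close>, for the lower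
bound \<open>q\<close> lies on the geodesic from \<open>u\<close>, and the roles of \<open>x\<close> and \<open>u\<close> are exchanged. In the second case the velocity at \<open>x\<close>
is still admissible, because \<open>p\<close> and \<open>q\<close> are at a distance of order \<open>s\<^sup>2\<close>.\<close>

lemma first_variation:
  assumes K: "x \<in> K" "y \<in> K" "u \<in> K" and c: "0 < c" "c \<le> d x y"
    and s: "0 < s" "s \<le> 1" "2 * s \<le> \<rho>" "(2 + \<kappa>) * s \<le> c" and xu: "dist x u = s\<^sup>2"
  shows "\<bar>d u y - (d x y - (u - x) \<bullet> direction x y)\<bar> \<le> variation_const * s ^ 3"
proof -
  define v where "v = direction x y"
  have L: "0 < d x y" using c by simp
  then have xy: "x \<noteq> y" using K by auto
  obtain \<gamma> where \<gamma>: "geodesic x y \<gamma>" using geodesic_ex K by blast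
  obtain \<eta> where \<eta>: "geodesic u y \<eta>" using geodesic_ex K by blast
  have ss: "s\<^sup>2 \<le> s" using s by (simp add: power2_eq_square mult_left_le)
  have dxu: "d x u \<le> (1 + \<kappa>) * s\<^sup>2" using le_local[OF K(1,3)] ss s xu by simp
  have "(1 + \<kappa>) * s\<^sup>2 \<le> (1 + \<kappa>) * s" using ss \<kappa>_nonneg by (intro mult_left_mono) auto
  then have L': "s \<le> d u y" "s \<le> d x y"
    using triangle[OF K(1,3,2)] dxu c s(4) mult_nonneg_nonneg[OF \<kappa>_nonneg, of s] s(1) unfolding distrib_right by linarith+
  define p where "p = \<gamma> s"
  define q where "q = \<eta> s"
  have pq: "p \<in> K" "q \<in> K" using geodesic_mem[OF \<gamma>] geodesic_mem[OF \<eta>] L' s by (auto simp: p_def q_def)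
  have p: "d x p = s" "d p y = d x y - s" using geodesic_ends[OF \<gamma> K(1,2)] L' s by (auto simp: p_def)
  have q: "d u q = s" "d q y = d u y - s" using geodesic_ends[OF \<eta> K(3,2)] L' s by (auto simp: q_def)
  have pv: "norm (p - x - s *\<^sub>R v) \<le> velocity_error * s\<^sup>2"
    unfolding p_def v_def using direction(2)[OF \<gamma> K(1,2) xy] L' s by auto
  have "d u p \<le> s - (u - x) \<bullet> v + (velocity_error + 1/2 + 8 * \<kappa>) * s ^ 3"
    using first_variation_upper[OF K(1,3) pq(1) s(1-3) xu _ pv] p by simp
  then have up: "d u y \<le> d x y - (u - x) \<bullet> v + (velocity_error + 1/2 + 8 * \<kappa>) * s ^ 3"
    using triangle[OF K(3) pq(1) K(2)] p by linarith
  have "dist q p \<le> 2 * d x u"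
    using dist_le[OF pq] geodesics_to_common_end[OF \<gamma> \<eta> K(2,1,3) _ L'(2,1) L] s
    by (simp add: p_def q_def dist_commute)
  then have "norm (q - p) \<le> 2 * ((1 + \<kappa>) * s\<^sup>2)" using dxu unfolding dist_norm by linarith
  then have "norm (q - p) \<le> 2 * (1 + \<kappa>) * s\<^sup>2" by (simp only: mult.assoc)
  moreover have "q - u - s *\<^sub>R v = (q - p) + (p - x - s *\<^sub>R v) + (x - u)" by simp
  then have "norm (q - u - s *\<^sub>R v) \<le> norm (q - p) + norm (p - x - s *\<^sub>R v) + norm (x - u)"
    by (metis norm_triangle_ineq norm_triangle_le add_mono_thms_linordered_semiring(3))
  ultimately have qv: "norm (q - u - s *\<^sub>R v) \<le> (2 * (1 + \<kappa>) + velocity_error + 1) * s\<^sup>2"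
    using pv xu by (simp add: dist_norm distrib_right)
  have "d x q \<le> s - (x - u) \<bullet> v + (2 * (1 + \<kappa>) + velocity_error + 1 + 1/2 + 8 * \<kappa>) * s ^ 3"
    using first_variation_upper[OF K(3,1) pq(2) s(1-3) _ _ qv] q xu by (simp add: dist_commute)
  then have low: "d x y \<le> d u y + (u - x) \<bullet> v + variation_const * s ^ 3"
    using triangle[OF K(1) pq(2) K(2)] q unfolding variation_const_def by (simp add: inner_diff_left)
  have "(velocity_error + 1/2 + 8 * \<kappa>) * s ^ 3 \<le> variation_const * s ^ 3"
    using s \<kappa>_nonneg by (intro mult_right_mono) (auto simp: variation_const_def)
  then show ?thesis using up low unfolding v_def[symmetric] abs_le_iff by linarith
qed

lemma variation_const_pos: "0 < variation_const"
  using \<kappa>_nonneg velocity_error_nonneg by (simp add: variation_const_def add_nonneg_pos)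

lemma first_variation_uniform:
  assumes c: "0 < c"
  obtains e where "0 < e" "e \<le> 1"
    "\<And>x y u. x \<in> K \<Longrightarrow> y \<in> K \<Longrightarrow> u \<in> K \<Longrightarrow> c \<le> d x y \<Longrightarrow> norm (u - x) \<le> e \<Longrightarrow>
       \<bar>d u y - d x y + direction x y \<bullet> (u - x)\<bar> \<le> variation_const * sqrt (norm (u - x)) * norm (u - x)"
proof -
  define b where "b = Min {1, \<rho> / 2, c / (2 + \<kappa>)}"
  have b: "b \<le> 1" "b \<le> \<rho> / 2" "b \<le> c / (2 + \<kappa>)" unfolding b_def by (intro Min_le; simp)+
  have "0 < b" using c \<rho>_pos \<kappa>_nonneg by (simp add: b_def)
  note b = this b
  show ?thesis
  proof (rule that[of "b\<^sup>2"])
    show "0 < b\<^sup>2" "b\<^sup>2 \<le> 1" using b by (auto intro: power_le_one)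
    fix x y u assume K: "x \<in> K" "y \<in> K" "u \<in> K" and cd: "c \<le> d x y" and ux: "norm (u - x) \<le> b\<^sup>2"
    define s where "s = sqrt (norm (u - x))"
    have s2: "s\<^sup>2 = norm (u - x)" by (simp add: s_def)
    have sb: "s \<le> b" using ux b real_sqrt_le_mono[OF ux] by (simp add: s_def)
    have "(2 + \<kappa>) * s \<le> (2 + \<kappa>) * b" using sb \<kappa>_nonneg by (intro mult_left_mono) auto
    also have "\<dots> \<le> c" using b(4) \<kappa>_nonneg by (simp add: pos_le_divide_eq mult.commute)
    finally have sc: "(2 + \<kappa>) * s \<le> c" .
    show "\<bar>d u y - d x y + direction x y \<bullet> (u - x)\<bar> \<le> variation_const * sqrt (norm (u - x)) * norm (u - x)"
    proof (cases "u = x")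
      case False
      then have "0 < s" by (simp add: s_def)
      then have "\<bar>d u y - (d x y - (u - x) \<bullet> direction x y)\<bar> \<le> variation_const * s ^ 3"
        using sb b s2 by (intro first_variation[OF K c cd _ _ _ sc]) (auto simp: dist_norm norm_minus_commute)
      moreover have "s ^ 3 = s * s\<^sup>2" by (simp add: power_numeral_reduce)
      then have "s ^ 3 = sqrt (norm (u - x)) * norm (u - x)" unfolding s2 by (simp add: s_def)
      ultimately show ?thesis by (simp add: inner_commute algebra_simps)
    qed simp
  qed
qed

lemma has_derivative_d_left:
  assumes K: "x \<in> K" "y \<in> K" and xy: "x \<noteq> y"
  shows "((\<lambda>u. d u y) has_derivative (\<lambda>h. - direction x y \<bullet> h)) (at x within K)"
proof -
  have L: "0 < d x y" using nonneg[OF K] eq_0D[OF K] xy by fastforce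
  obtain e where e: "0 < e"
    "\<And>u. u \<in> K \<Longrightarrow> norm (u - x) \<le> e \<Longrightarrow>
       \<bar>d u y - d x y + direction x y \<bullet> (u - x)\<bar> \<le> variation_const * sqrt (norm (u - x)) * norm (u - x)"
  proof (rule first_variation_uniform[OF L])
    fix e assume "0 < e" "\<And>x' y' u. x' \<in> K \<Longrightarrow> y' \<in> K \<Longrightarrow> u \<in> K \<Longrightarrow> d x y \<le> d x' y' \<Longrightarrow> norm (u - x') \<le> e \<Longrightarrow>
       \<bar>d u y' - d x' y' + direction x' y' \<bullet> (u - x')\<bar> \<le> variation_const * sqrt (norm (u - x')) * norm (u - x')"
    then show thesis using K by (intro that[of e]) auto
  qed
  show ?thesis
    by (rule has_derivative_within_of_bound[OF _ e(1), where C = variation_const])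
      (use e(2) in \<open>auto intro!: bounded_linear_inner_right bounded_linear_minus\<close>)
qed

text \<open>The second variable is moved first. Then the velocity at \<open>x\<close> towards the new end \<open>v\<close> occurs, which is
replaced by the one towards \<open>y\<close> by means of \<open>direction_Lipschitz\<close>.\<close>

lemma has_derivative_d:
  assumes K: "x \<in> K" "y \<in> K" and xy: "x \<noteq> y"
  shows "((\<lambda>(u, v). d u v) has_derivative (\<lambda>h. (- direction x y, - direction y x) \<bullet> h)) (at (x, y) within K \<times> K)"
proof -
  define c where "c = d x y / 2"
  have c: "0 < c" using nonneg[OF K] eq_0D[OF K] xy by (fastforce simp: c_def)
  obtain e where e: "0 < e" "e \<le> 1"
    and var: "\<And>x y u. x \<in> K \<Longrightarrow> y \<in> K \<Longrightarrow> u \<in> K \<Longrightarrow> c \<le> d x y \<Longrightarrow> norm (u - x) \<le> e \<Longrightarrow>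
       \<bar>d u y - d x y + direction x y \<bullet> (u - x)\<bar> \<le> variation_const * sqrt (norm (u - x)) * norm (u - x)"
    by (rule first_variation_uniform[OF c]) (rule that)
  define b where "b = Min {e, \<rho>, c / (1 + \<kappa>)}"
  have b: "0 < b" "b \<le> e" "b \<le> \<rho>" "b \<le> c / (1 + \<kappa>)"
    using e c \<rho>_pos \<kappa>_nonneg by (auto simp: b_def)
  show ?thesis
  proof (rule has_derivative_within_of_bound[OF bounded_linear_inner_right b(1), where C = "2 * variation_const + (1 + \<kappa>) / c"])
    fix z assume z: "z \<in> K \<times> K" "norm (z - (x, y)) < b"
    obtain u v where uv: "z = (u, v)" by force
    define h where "h = norm (z - (x, y))"
    have Kuv: "u \<in> K" "v \<in> K" using z uv by auto
    have hb: "norm (u - x) \<le> h" "norm (v - y) \<le> h" "0 \<le> h" "h < b"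
      using z(2) norm_fst_le[of "u - x" "v - y"] norm_snd_le[of "v - y" "u - x"] by (auto simp: h_def uv)
    have yv: "d y v \<le> (1 + \<kappa>) * h"
    proof -
      have "d y v \<le> (1 + \<kappa>) * dist y v"
        using hb b e by (intro le_local K Kuv) (auto simp: dist_norm norm_minus_commute)
      also have "\<dots> \<le> (1 + \<kappa>) * h" using hb \<kappa>_nonneg by (intro mult_left_mono) (auto simp: dist_norm norm_minus_commute)
      finally show ?thesis .
    qed
    have "(1 + \<kappa>) * h \<le> (1 + \<kappa>) * b" using hb \<kappa>_nonneg by (intro mult_left_mono) auto
    also have "\<dots> \<le> c" using b(4) \<kappa>_nonneg by (simp add: pos_le_divide_eq mult.commute)
    finally have "d y v \<le> c" using yv by simp
    then have cv: "c \<le> d x v" using triangle[OF K(1) Kuv(2) K(2)] sym[OF K(2) Kuv(2)] by (simp add: c_def)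
    then have xv: "x \<noteq> v" using c K by auto
    have mono: "variation_const * sqrt (norm w) * norm w \<le> variation_const * sqrt h * h" if "norm w \<le> h" for w :: 'a
      using that hb variation_const_pos by (intro mult_mono mult_left_mono) auto
    have 1: "\<bar>d u v - d x v + direction x v \<bullet> (u - x)\<bar> \<le> variation_const * sqrt h * h"
      using var[OF K(1) Kuv(2,1) cv] mono[OF hb(1)] hb b by linarith
    have "c \<le> d y x" using c sym[OF K] by (simp add: c_def)
    then have "\<bar>d v x - d y x + direction y x \<bullet> (v - y)\<bar> \<le> variation_const * sqrt h * h"
      using var[OF K(2,1) Kuv(2)] mono[OF hb(2)] hb b by linarith
    then have 2: "\<bar>d x v - d x y + direction y x \<bullet> (v - y)\<bar> \<le> variation_const * sqrt h * h"
      using sym[OF K] sym[OF K(1) Kuv(2)] by simp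
    have 3: "\<bar>(direction x y - direction x v) \<bullet> (u - x)\<bar> \<le> (1 + \<kappa>) / c * sqrt h * h"
    proof -
      have "norm (direction x y - direction x v) \<le> 2 * d y v / d x y"
        by (rule direction_Lipschitz[OF K Kuv(2) xy xv])
      also have "\<dots> = d y v / c" by (simp add: c_def)
      also have "\<dots> \<le> (1 + \<kappa>) * h / c" using yv c by (intro divide_right_mono) auto
      also have "\<dots> \<le> (1 + \<kappa>) * sqrt h / c"
      proof -
        have "sqrt h * sqrt h \<le> 1 * sqrt h" using hb b e by (intro mult_right_mono) auto
        then have "h \<le> sqrt h" using hb by simp
        then show ?thesis using c \<kappa>_nonneg by (intro divide_right_mono mult_left_mono) auto
      qed
      finally have n: "norm (direction x y - direction x v) \<le> (1 + \<kappa>) / c * sqrt h" by simp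
      have "\<bar>(direction x y - direction x v) \<bullet> (u - x)\<bar> \<le> norm (direction x y - direction x v) * norm (u - x)"
        by (rule Cauchy_Schwarz_ineq2)
      also have "\<dots> \<le> (1 + \<kappa>) / c * sqrt h * h"
        using n hb order_trans[OF norm_ge_zero n] by (intro mult_mono) auto
      finally show ?thesis .
    qed
    have "(case z of (u, v) \<Rightarrow> d u v) - (case (x, y) of (u, v) \<Rightarrow> d u v) - (- direction x y, - direction y x) \<bullet> (z - (x, y))
       = (d u v - d x v + direction x v \<bullet> (u - x)) + (d x v - d x y + direction y x \<bullet> (v - y))
         + (direction x y - direction x v) \<bullet> (u - x)"
      by (simp add: uv inner_diff_left)
    then have "norm ((case z of (u, v) \<Rightarrow> d u v) - (case (x, y) of (u, v) \<Rightarrow> d u v) - (- direction x y, - direction y x) \<bullet> (z - (x, y)))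
       \<le> variation_const * sqrt h * h + variation_const * sqrt h * h + (1 + \<kappa>) / c * sqrt h * h"
      using 1 2 3 unfolding real_norm_def by linarith
    then show "norm ((case z of (u, v) \<Rightarrow> d u v) - (case (x, y) of (u, v) \<Rightarrow> d u v) - (- direction x y, - direction y x) \<bullet> (z - (x, y)))
       \<le> (2 * variation_const + (1 + \<kappa>) / c) * sqrt (norm (z - (x, y))) * norm (z - (x, y))"
      unfolding h_def[symmetric] by (simp only: distrib_right mult_2)
  qed
qed

end

section \<open>The intrinsic metric on the closure\<close>

text \<open>On the frontier the extended metric is defined as a limit. This identifies it with the continuous extension,
through which identities and inequalities pass from \<open>D\<close> to its closure.\<close>

lemma intr_dist_tendsto:
  fixes D :: "'a::euclidean_space set"
  assumes "open D" "uniformly_continuous_on (D \<times> D) (\<lambda>(u, v). intr_dist_on D u v)"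
    and x: "x \<in> closure D" and y: "y \<in> closure D"
    and f: "\<And>n. f n \<in> D" "f \<longlonglongrightarrow> x" and g: "\<And>n. g n \<in> D" "g \<longlonglongrightarrow> y"
  shows "(\<lambda>n. intr_dist_on D (f n) (g n)) \<longlonglongrightarrow> intr_dist D x y"
proof -
  define d where "d = (\<lambda>(u, v). intr_dist_on D u v)"
  obtain G where G: "uniformly_continuous_on (closure (D \<times> D)) G" "\<And>z. z \<in> D \<times> D \<Longrightarrow> d z = G z"
    using uniformly_continuous_on_extension_on_closure[OF assms(2)] unfolding d_def by metis
  have cont: "continuous_on (closure D \<times> closure D) G"
    using uniformly_continuous_imp_continuous[OF G(1)] by (simp add: closure_Times)
  have "intr_dist D x y = G (x, y)"
  proof (cases "x \<in> D \<and> y \<in> D")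
    case True
    then show ?thesis using G(2)[of "(x, y)"] by (simp add: intr_dist_def d_def)
  next
    case False
    have "(x, y) \<in> closure (D \<times> D)" using x y by (simp add: closure_Times)
    then have nontriv: "\<not> trivial_limit (at (x, y) within D \<times> D)"
      using False unfolding trivial_limit_within closure_def by auto
    have "(G \<longlongrightarrow> G (x, y)) (at (x, y) within closure D \<times> closure D)"
      using cont x y by (auto simp: continuous_on_def)
    then have "(G \<longlongrightarrow> G (x, y)) (at (x, y) within D \<times> D)"
      by (rule tendsto_within_subset) (use closure_subset in auto)
    moreover have "\<forall>\<^sub>F z in at (x, y) within D \<times> D. d z = G z"
      using G(2) by (auto simp: eventually_at_filter intro!: always_eventually)
    ultimately have "(d \<longlongrightarrow> G (x, y)) (at (x, y) within D \<times> D)" using tendsto_cong by blast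
    then have "Lim (at (x, y) within D \<times> D) d = G (x, y)" by (rule tendsto_Lim[OF nontriv])
    then show ?thesis using False by (auto simp: intr_dist_def d_def)
  qed
  moreover have "(\<lambda>n. G (f n, g n)) \<longlonglongrightarrow> G (x, y)"
  proof (rule continuous_on_tendsto_compose[OF cont])
    show "(\<lambda>n. (f n, g n)) \<longlonglongrightarrow> (x, y)" by (intro tendsto_Pair f g)
    show "\<forall>\<^sub>F n in sequentially. (f n, g n) \<in> closure D \<times> closure D"
      using f g closure_subset by (intro always_eventually) auto
  qed (use x y in auto)
  moreover have "G (f n, g n) = intr_dist_on D (f n) (g n)" for n
    using G(2)[of "(f n, g n)"] f g by (simp add: d_def)
  ultimately show ?thesis by simp
qed

lemma euclidean_stewart:
  fixes a b c :: "'a::real_inner"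
  shows "(dist (a + l *\<^sub>R (b - a)) c)\<^sup>2 = (1 - l) * (dist a c)\<^sup>2 + l * (dist b c)\<^sup>2 - l * (1 - l) * (dist a b)\<^sup>2"
proof -
  have "a + l *\<^sub>R (b - a) - c = (1 - l) *\<^sub>R (a - c) - l *\<^sub>R (c - b)" by (simp add: algebra_simps)
  then show ?thesis
    using stewart_identity[of "1 - l" "a - c" l "c - b"] by (simp add: dist_norm norm_minus_commute)
qed

text \<open>The third vertex is found from the law of cosines; its second coordinate is real by the triangle
inequalities, through the factorisation in Heron's formula.\<close>

lemma comparison_triangle_exists:
  fixes A B C :: real
  assumes "0 \<le> A" "0 \<le> B" "0 \<le> C" "A \<le> B + C" "B \<le> A + C" "C \<le> A + B"
  shows "\<exists>a b c :: real ^ 2. dist a b = A \<and> dist a c = B \<and> dist b c = C"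
proof -
  have n: "norm (vector [x, y] :: real ^ 2) = sqrt (x\<^sup>2 + y\<^sup>2)" for x y
    by (simp add: norm_vec_def L2_set_def sum_2)
  have df: "vector [x, y] - vector [x', y'] = (vector [x - x', y - y'] :: real ^ 2)" for x y x' y' :: real
    by (simp add: vec_eq_iff forall_2)
  have z: "(0 :: real ^ 2) = vector [0, 0]" by (simp add: vec_eq_iff forall_2)
  show ?thesis
  proof (cases "A = 0")
    case True
    then have "B = C" using assms by simp
    then show ?thesis
      using True assms by (intro exI[of _ 0] exI[of _ "vector [B, 0]"]) (simp add: dist_norm n)
  next
    case False
    then have A: "A > 0" using assms by simp
    define x where "x = (A\<^sup>2 + B\<^sup>2 - C\<^sup>2) / (2 * A)"
    have x: "2 * A * x = A\<^sup>2 + B\<^sup>2 - C\<^sup>2" using A by (simp add: x_def)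
    have "(2 * A)\<^sup>2 * (B\<^sup>2 - x\<^sup>2) = (2 * A * B)\<^sup>2 - (2 * A * x)\<^sup>2" by (simp add: power_mult_distrib algebra_simps)
    also have "\<dots> = ((C - A + B) * (C + A - B)) * ((A + B - C) * (A + B + C))"
      unfolding x by (simp add: power2_eq_square algebra_simps)
    also have "\<dots> \<ge> 0" using assms by (intro mult_nonneg_nonneg) auto
    finally have "0 \<le> B\<^sup>2 - x\<^sup>2" using A by (simp add: zero_le_mult_iff)
    then have y: "(sqrt (B\<^sup>2 - x\<^sup>2))\<^sup>2 = B\<^sup>2 - x\<^sup>2" by simp
    have "(A - x)\<^sup>2 + (B\<^sup>2 - x\<^sup>2) = C\<^sup>2" using x by (simp add: power2_diff)
    then have "dist (0 :: real ^ 2) (vector [A, 0]) = A \<and> dist (0 :: real ^ 2) (vector [x, sqrt (B\<^sup>2 - x\<^sup>2)]) = B \<and>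
       dist (vector [A, 0] :: real ^ 2) (vector [x, sqrt (B\<^sup>2 - x\<^sup>2)]) = C"
      using assms y by (simp add: dist_norm df n)
    then show ?thesis by blast
  qed
qed

lemma cos_vec_angle:
  fixes v w :: "'a::real_inner"
  shows "norm v * norm w * cos (vec_angle v w) = v \<bullet> w"
proof (cases "v = 0 \<or> w = 0")
  case False
  then have p: "0 < norm v * norm w" by simp
  have "\<bar>v \<bullet> w\<bar> \<le> norm v * norm w" by (rule Cauchy_Schwarz_ineq2)
  then have "- 1 \<le> (v \<bullet> w) / (norm v * norm w)" "(v \<bullet> w) / (norm v * norm w) \<le> 1"
    using p by (simp_all add: pos_le_divide_eq pos_divide_le_eq abs_le_iff)
  then show ?thesis using p unfolding vec_angle_def by (subst cos_arccos) auto
qed auto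

text \<open>The radius is halved because the cubic bound at the points of the closure is a limit of the bounds at nearby points
of \<open>D\<close>, whose distance may be slightly larger.\<close>

lemma intr_dist_cubic_metric:
  fixes D :: "'a::euclidean_space set"
  assumes D: "open D" "connected D" "bounded D" and r: "0 < r" "uniform_exterior_sphere r D"
    and \<alpha>: "0 < \<alpha>" "\<alpha> \<le> pi / 2" and \<delta>: "0 < \<delta>" "uniform_interior_cone \<delta> \<alpha> D"
  defines "\<kappa> \<equiv> 1 / (9 * r\<^sup>2)" and "\<rho> \<equiv> min r (\<delta> / 8)"
  shows "uniformly_continuous_on (D \<times> D) (\<lambda>(u, v). intr_dist_on D u v)"
    and "cubic_metric (closure D) (intr_dist D) \<kappa> (\<rho> / 2)"
proof -
  have \<kappa>: "0 \<le> \<kappa>" and \<rho>: "0 < \<rho>" using r \<delta> by (auto simp: \<kappa>_def \<rho>_def)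
  have cubic: "intr_dist_on D u v \<le> dist u v + \<kappa> * dist u v ^ 3" if "u \<in> D" "v \<in> D" "dist u v \<le> \<rho>" for u v
    using intr_dist_on_le_cubic[OF D(1,2) r \<alpha> \<delta> that(1,2)] that by (simp add: \<kappa>_def \<rho>_def)
  show uc: "uniformly_continuous_on (D \<times> D) (\<lambda>(u, v). intr_dist_on D u v)"
    unfolding uniformly_continuous_on_def
  proof (intro allI impI)
    fix e :: real assume e: "e > 0"
    define h where "h = Min {\<rho>, 1, e / (4 * (1 + \<kappa>))}"
    have h: "0 < h" "h \<le> \<rho>" "h \<le> 1" "h \<le> e / (4 * (1 + \<kappa>))"
      using e \<rho> \<kappa> by (auto simp: h_def)
    have small: "intr_dist_on D u v < e / 2" if uv: "u \<in> D" "v \<in> D" "dist u v < h" for u v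
    proof -
      have "dist u v ^ 3 \<le> dist u v" using power_decreasing[of 1 3 "dist u v"] uv h by simp
      then have "\<kappa> * dist u v ^ 3 \<le> \<kappa> * dist u v" using \<kappa> by (rule mult_left_mono)
      then have "intr_dist_on D u v \<le> (1 + \<kappa>) * dist u v" using cubic[of u v] uv h by (simp add: algebra_simps)
      also have "\<dots> \<le> (1 + \<kappa>) * h" using uv \<kappa> by (intro mult_left_mono) auto
      also have "\<dots> \<le> e / 4" using h(4) \<kappa> by (simp add: pos_le_divide_eq algebra_simps)
      finally show ?thesis using e by simp
    qed
    have "\<bar>intr_dist_on D u' v' - intr_dist_on D u v\<bar> < e"
      if m: "u \<in> D" "v \<in> D" "u' \<in> D" "v' \<in> D" "dist (u', v') (u, v) < h" for u v u' v'
    proof -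
      have "dist u' u < h" "dist v' v < h"
        using m(5) dist_fst_le[of "(u', v')" "(u, v)"] dist_snd_le[of "(u', v')" "(u, v)"] by auto
      then have "intr_dist_on D u' u < e / 2" "intr_dist_on D v' v < e / 2" using small m by auto
      then show ?thesis
        using intr_dist_on_triangle[OF D(1,2), of u' u v'] intr_dist_on_triangle[OF D(1,2), of u v v']
          intr_dist_on_triangle[OF D(1,2), of u u' v] intr_dist_on_triangle[OF D(1,2), of u' v' v]
          intr_dist_on_sym[OF D(1,2), of u u'] intr_dist_on_sym[OF D(1,2), of v v'] m
        by (simp add: abs_less_iff)
    qed
    then show "\<exists>d>0. \<forall>x\<in>D \<times> D. \<forall>x'\<in>D \<times> D. dist x' x < d \<longrightarrow>
        dist (case x' of (u, v) \<Rightarrow> intr_dist_on D u v) (case x of (u, v) \<Rightarrow> intr_dist_on D u v) < e"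
      using h(1) by (intro exI[of _ h]) (auto simp: dist_real_def)
  qed
  have seq: "\<exists>f. (\<forall>n. f n \<in> D) \<and> f \<longlonglongrightarrow> x" if "x \<in> closure D" for x
    using that closure_sequential by blast
  note lim = intr_dist_tendsto[OF D(1) uc]
  show "cubic_metric (closure D) (intr_dist D) \<kappa> (\<rho> / 2)"
  proof
    show "compact (closure D)" using D(3) by (simp add: compact_closure)
    show "0 < \<rho> / 2" "0 \<le> \<kappa>" using \<rho> \<kappa> by auto
  next
    fix x y assume xy: "x \<in> closure D" "y \<in> closure D"
    obtain f where f: "\<And>n. f n \<in> D" "f \<longlonglongrightarrow> x" using seq[OF xy(1)] by blast
    obtain g where g: "\<And>n. g n \<in> D" "g \<longlonglongrightarrow> y" using seq[OF xy(2)] by blast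
    show "intr_dist D x y = intr_dist D y x"
    proof (rule LIMSEQ_unique[OF lim[OF xy f g]])
      show "(\<lambda>n. intr_dist_on D (f n) (g n)) \<longlonglongrightarrow> intr_dist D y x"
        using lim[OF xy(2,1) g f] intr_dist_on_sym[OF D(1,2) f(1) g(1)] by simp
    qed
    have lim_dist: "(\<lambda>n. dist (f n) (g n)) \<longlonglongrightarrow> dist x y" by (intro tendsto_dist f g)
    show "dist x y \<le> intr_dist D x y"
      by (rule LIMSEQ_le[OF lim_dist lim[OF xy f g]]) (use dist_le_intr_dist_on[OF D(1,2) f(1) g(1)] in blast)
    show "intr_dist D x y \<le> dist x y + \<kappa> * dist x y ^ 3" if "dist x y \<le> \<rho> / 2"
    proof (rule tendsto_le[OF _ _ lim[OF xy f g]])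
      show "(\<lambda>n. dist (f n) (g n) + \<kappa> * dist (f n) (g n) ^ 3) \<longlonglongrightarrow> dist x y + \<kappa> * dist x y ^ 3"
        by (intro tendsto_intros lim_dist)
      have "\<forall>\<^sub>F n in sequentially. dist (f n) (g n) < \<rho>"
        using order_tendstoD(2)[OF lim_dist, of \<rho>] that \<rho> by simp
      then show "\<forall>\<^sub>F n in sequentially. intr_dist_on D (f n) (g n) \<le> dist (f n) (g n) + \<kappa> * dist (f n) (g n) ^ 3"
        by eventually_elim (use cubic f g in auto)
    qed simp
    fix z assume z: "z \<in> closure D"
    obtain h where h: "\<And>n. h n \<in> D" "h \<longlonglongrightarrow> z" using seq[OF z] by blast
    show "intr_dist D x z \<le> intr_dist D x y + intr_dist D y z"
      by (rule LIMSEQ_le[OF lim[OF xy(1) z f h] tendsto_add[OF lim[OF xy f g] lim[OF xy(2) z g h]]])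
        (use intr_dist_on_triangle[OF D(1,2) f(1) g(1) h(1)] in blast)
  qed
qed

text \<open>Approximating both ends from \<open>D\<close>, the almost intermediate points of almost shortest paths accumulate at an
intermediate point.\<close>

lemma intr_dist_between:
  fixes D :: "'a::euclidean_space set"
  assumes D: "open D" "connected D"
    and uc: "uniformly_continuous_on (D \<times> D) (\<lambda>(u, v). intr_dist_on D u v)"
    and cm: "cubic_metric (closure D) (intr_dist D) \<kappa> \<rho>"
    and x: "x \<in> closure D" and y: "y \<in> closure D" and a: "0 \<le> a" "a \<le> intr_dist D x y"
  shows "\<exists>p\<in>closure D. intr_dist D x p = a \<and> intr_dist D p y = intr_dist D x y - a"
proof -
  interpret cubic_metric "closure D" "intr_dist D" \<kappa> \<rho> by (rule cm)
  note lim = intr_dist_tendsto[OF D(1) uc]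
  obtain f where f: "\<And>n. f n \<in> D" "f \<longlonglongrightarrow> x" using x closure_sequential by metis
  obtain g where g: "\<And>n. g n \<in> D" "g \<longlonglongrightarrow> y" using y closure_sequential by metis
  define L where "L n = intr_dist_on D (f n) (g n)" for n
  define b where "b n = min a (L n)" for n
  have L: "L \<longlonglongrightarrow> intr_dist D x y" unfolding L_def by (rule lim[OF x y f g])
  then have "(\<lambda>n. min a (L n)) \<longlonglongrightarrow> min a (intr_dist D x y)" by (intro tendsto_min tendsto_const)
  then have b: "b \<longlonglongrightarrow> a" using a by (simp add: b_def[abs_def])
  have cont: "continuous_on D (intr_dist_on D u)" if "u \<in> D" for u
  proof (rule continuous_on_compose2[OF uniformly_continuous_imp_continuous[OF uc], of D "\<lambda>v. (u, v)", simplified])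
    show "continuous_on D (Pair u)" by (intro continuous_intros)
  qed (use that in auto)
  have L0: "0 \<le> L n" for n by (simp add: L_def intr_dist_on_def)
  have "\<exists>p\<in>D. intr_dist_on D (f n) p = b n \<and> intr_dist_on D p (g n) \<le> L n - b n + 1 / real (Suc n)" for n
  proof -
    have "0 \<le> b n" "b n \<le> intr_dist_on D (f n) (g n)" "0 < 1 / real (Suc n)"
      using a L0[of n] by (auto simp: b_def L_def)
    from intr_dist_on_approx_between[OF D f(1) g(1) this cont[OF f(1)]]
    show ?thesis unfolding L_def by metis
  qed
  then obtain p where p: "\<And>n. p n \<in> D" "\<And>n. intr_dist_on D (f n) (p n) = b n"
    "\<And>n. intr_dist_on D (p n) (g n) \<le> L n - b n + 1 / real (Suc n)" by metis
  have "\<forall>n. p n \<in> closure D" using p closure_subset by blast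
  then obtain q s where q: "q \<in> closure D" "strict_mono s" "(p \<circ> s) \<longlonglongrightarrow> q"
    using compact unfolding compact_def by metis
  have sub: "(\<lambda>n. f (s n)) \<longlonglongrightarrow> x" "(\<lambda>n. g (s n)) \<longlonglongrightarrow> y" "(\<lambda>n. p (s n)) \<longlonglongrightarrow> q"
    "(\<lambda>n. L (s n)) \<longlonglongrightarrow> intr_dist D x y" "(\<lambda>n. b (s n)) \<longlonglongrightarrow> a" "(\<lambda>n. 1 / real (Suc (s n))) \<longlonglongrightarrow> 0"
    using LIMSEQ_subseq_LIMSEQ[OF f(2) q(2)] LIMSEQ_subseq_LIMSEQ[OF g(2) q(2)] q(3)
      LIMSEQ_subseq_LIMSEQ[OF L q(2)] LIMSEQ_subseq_LIMSEQ[OF b q(2)]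
      LIMSEQ_subseq_LIMSEQ[OF LIMSEQ_Suc[OF lim_1_over_n] q(2)]
    by (auto simp: o_def)
  have 1: "intr_dist D x q = a"
    using LIMSEQ_unique[OF lim[OF x q(1) f(1) sub(1) p(1) sub(3)]] sub(5) by (simp add: p(2))
  have "intr_dist D q y \<le> intr_dist D x y - a + 0"
    by (rule LIMSEQ_le[OF lim[OF q(1) y p(1) sub(3) g(1) sub(2)] tendsto_add[OF tendsto_diff[OF sub(4,5)] sub(6)]])
      (use p(3) in blast)
  then show ?thesis using q(1) 1 triangle[OF x q(1) y] by (intro bexI[of _ q]) auto
qed

lemma unit_speed_geodesic_iff:
  assumes "cubic_metric (closure D) (intr_dist D) \<kappa> \<rho>" "x \<in> closure D" "y \<in> closure D"
  shows "unit_speed_geodesic D x y \<gamma> \<longleftrightarrow> cubic_metric.geodesic (closure D) (intr_dist D) x y \<gamma>"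
proof -
  interpret cubic_metric "closure D" "intr_dist D" \<kappa> \<rho> by (rule assms)
  show ?thesis
  proof
    show "geodesic x y \<gamma>" if "unit_speed_geodesic D x y \<gamma>"
      using that assms(2,3) unfolding unit_speed_geodesic_def by (intro geodesic_of_curve_length) auto
    show "unit_speed_geodesic D x y \<gamma>" if "geodesic x y \<gamma>"
      using geodesic_curve_length[OF that] that unfolding unit_speed_geodesic_def geodesic_def by auto
  qed
qed

text \<open>Stewart's inequality for ends in \<open>D\<close> is the comparison property with one of the two points being the vertex \<open>z\<close>;
the closure is then covered by \<open>stewart_from_dense\<close>.\<close>

lemma intr_dist_cat0_cubic_metric:
  fixes D :: "'a::euclidean_space set"
  assumes D: "open D" "connected D" "cat0 D"
    and uc: "uniformly_continuous_on (D \<times> D) (\<lambda>(u, v). intr_dist_on D u v)"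
    and cm: "cubic_metric (closure D) (intr_dist D) \<kappa> \<rho>"
  shows "cat0_cubic_metric (closure D) (intr_dist D) \<kappa> \<rho>"
proof -
  interpret cubic_metric "closure D" "intr_dist D" \<kappa> \<rho> by (rule cm)
  let ?d = "intr_dist D"
  have ex: "\<exists>\<gamma>. geodesic x y \<gamma>" if "x \<in> closure D" "y \<in> closure D" for x y
    by (rule geodesic_exists[OF intr_dist_between[OF D(1,2) uc cm]]) (use that in auto)
  have stew: "\<exists>m\<in>closure D. \<forall>z\<in>D. (?d z m)\<^sup>2 \<le> (1 - l) * (?d z a)\<^sup>2 + l * (?d z b)\<^sup>2 - l * (1 - l) * (?d a b)\<^sup>2"
    if ab: "a \<in> D" "b \<in> D" and l: "0 \<le> l" "l \<le> 1" for a b l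
  proof -
    have K: "z \<in> closure D" if "z \<in> D" for z using that closure_subset by auto
    obtain \<gamma> where \<gamma>: "geodesic a b \<gamma>" using ex K ab by blast
    have lL: "l * ?d a b \<in> {0..?d a b}" using l nonneg K ab by (auto simp: mult_left_le_one_le)
    define m where "m = \<gamma> (l * ?d a b)"
    have m: "m \<in> closure D" unfolding m_def using geodesic_mem[OF \<gamma>] lL by auto
    have "(?d z m)\<^sup>2 \<le> (1 - l) * (?d z a)\<^sup>2 + l * (?d z b)\<^sup>2 - l * (1 - l) * (?d a b)\<^sup>2" if z: "z \<in> D" for z
    proof -
      obtain \<eta> \<beta> where \<eta>: "geodesic a z \<eta>" and \<beta>: "geodesic b z \<beta>" using ex K ab z by metis
      have s: "?d a z = ?d z a" "?d b z = ?d z b" "?d m z = ?d z m" using sym K m ab z by auto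
      obtain a' b' c' :: "real ^ 2" where t: "dist a' b' = ?d a b" "dist a' c' = ?d a z" "dist b' c' = ?d b z"
        using comparison_triangle_exists[of "?d a b" "?d a z" "?d b z"] nonneg K ab z
          triangle[of a z b] triangle[of a b z] triangle[of b a z] sym[of a b] s by auto
      have az: "?d a z \<in> {0..?d a z}" "\<eta> (?d a z) = z" using nonneg K ab z \<eta> by (auto simp: geodesic_def)
      have "unit_speed_geodesic D a b \<gamma>" "unit_speed_geodesic D a z \<eta>" "unit_speed_geodesic D b z \<beta>"
        using unit_speed_geodesic_iff[OF cm] \<gamma> \<eta> \<beta> K ab z by auto
      then have "?d (\<gamma> (l * ?d a b)) (\<eta> (?d a z)) \<le> dist (along_segment a' b' (l * ?d a b)) (along_segment a' c' (?d a z))"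
        using D(3) ab z t lL az(1) unfolding cat0_def by blast
      moreover have "along_segment a' b' (l * ?d a b) = a' + l *\<^sub>R (b' - a')"
        by (cases "a' = b'") (simp_all add: along_segment_def t(1)[symmetric])
      moreover have "along_segment a' c' (?d a z) = c'"
        by (cases "a' = c'") (simp_all add: along_segment_def t(2)[symmetric])
      ultimately have "?d m z \<le> dist (a' + l *\<^sub>R (b' - a')) c'" by (simp add: m_def az(2))
      then have "(?d m z)\<^sup>2 \<le> (dist (a' + l *\<^sub>R (b' - a')) c')\<^sup>2" using nonneg m K z by (intro power_mono) auto
      then show ?thesis unfolding euclidean_stewart t s .
    qed
    then show ?thesis using m by blast
  qed
  show ?thesis
  proof (intro cat0_cubic_metric.intro cat0_cubic_metric_axioms.intro)
    show "cubic_metric (closure D) ?d \<kappa> \<rho>" by (rule cm)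
    show "\<exists>\<gamma>. cubic_metric.geodesic (closure D) ?d x y \<gamma>" if "x \<in> closure D" "y \<in> closure D" for x y
      by (rule ex[OF that])
    show "(?d z (\<gamma> (l * ?d a b)))\<^sup>2 \<le> (1 - l) * (?d z a)\<^sup>2 + l * (?d z b)\<^sup>2 - l * (1 - l) * (?d a b)\<^sup>2"
      if "cubic_metric.geodesic (closure D) ?d a b \<gamma>" "a \<in> closure D" "b \<in> closure D" "z \<in> closure D" "0 \<le> l" "l \<le> 1"
      for a b \<gamma> z l
      by (rule stewart_from_dense[OF closure_subset order_refl stew that])
  qed
qed

theorem proposition14:
  fixes D :: "(real ^ 'd) set" and r \<delta> \<alpha> :: real
  assumes "CARD('d) \<ge> 2"
    and "open D" and "connected D" and "bounded D"
    and "cat0 D"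
    and "r > 0" and "uniform_exterior_sphere r D"
    and "\<delta> > 0" and "0 < \<alpha>" and "\<alpha> \<le> pi / 2" and "uniform_interior_cone \<delta> \<alpha> D"
  shows "(\<forall>c1 > 0. \<exists>c2 > 0. \<exists>c3 > 0. \<forall>x \<in> closure D. \<forall>y \<in> closure D. \<forall>u \<in> closure D.
            u \<noteq> x \<and> intr_dist D x y \<ge> c1 \<and> max (sqrt (norm (u - x))) (norm (u - x)) \<le> c2 \<longrightarrow>
            \<bar>intr_dist D u y -
              (intr_dist D x y + norm (u - x) * cos (vec_angle (- init_dir D x y) (u - x)))\<bar>
            \<le> c3 * norm (u - x) powr (3 / 2)) \<and>
         (\<forall>x \<in> closure D. \<forall>y \<in> closure D. x \<noteq> y \<longrightarrow>
            has_gradient_within (\<lambda>u. intr_dist D u y) (- init_dir D x y) x (closure D)) \<and>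
         (\<forall>x \<in> closure D. \<forall>y \<in> closure D. x \<noteq> y \<longrightarrow>
            has_gradient_within (\<lambda>(u, v). intr_dist D u v) (- init_dir D x y, - init_dir D y x) (x, y)
              (closure D \<times> closure D))"
proof -
  let ?\<kappa> = "1 / (9 * r\<^sup>2)" and ?\<rho> = "min r (\<delta> / 8) / 2"
  note cm = intr_dist_cubic_metric[OF assms(2,3,4,6,7,9,10,8,11)]
  interpret cat0_cubic_metric "closure D" "intr_dist D" ?\<kappa> ?\<rho>
    by (rule intr_dist_cat0_cubic_metric[OF assms(2,3,5) cm])
  have dir: "init_dir D x y = direction x y" if "x \<in> closure D" "y \<in> closure D" for x y
    unfolding init_dir_def direction_def unit_speed_geodesic_iff[OF cm(2) that] ..
  show ?thesis
  proof (intro conjI allI ballI impI)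
    fix c1 :: real assume c1: "c1 > 0"
    obtain e where e: "0 < e" "e \<le> 1" and var: "\<And>x y u. x \<in> closure D \<Longrightarrow> y \<in> closure D \<Longrightarrow> u \<in> closure D \<Longrightarrow>
        c1 \<le> intr_dist D x y \<Longrightarrow> norm (u - x) \<le> e \<Longrightarrow>
       \<bar>intr_dist D u y - intr_dist D x y + direction x y \<bullet> (u - x)\<bar> \<le> variation_const * sqrt (norm (u - x)) * norm (u - x)"
      by (rule first_variation_uniform[OF c1]) (rule that)
    show "\<exists>c2>0. \<exists>c3>0. \<forall>x \<in> closure D. \<forall>y \<in> closure D. \<forall>u \<in> closure D.
            u \<noteq> x \<and> intr_dist D x y \<ge> c1 \<and> max (sqrt (norm (u - x))) (norm (u - x)) \<le> c2 \<longrightarrow>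
            \<bar>intr_dist D u y -
              (intr_dist D x y + norm (u - x) * cos (vec_angle (- init_dir D x y) (u - x)))\<bar>
            \<le> c3 * norm (u - x) powr (3 / 2)"
    proof (rule exI[of _ e], intro conjI e(1), rule exI[of _ variation_const],
        intro conjI ballI impI variation_const_pos)
      fix x y u assume K: "x \<in> closure D" "y \<in> closure D" "u \<in> closure D"
        and a: "u \<noteq> x \<and> c1 \<le> intr_dist D x y \<and> max (sqrt (norm (u - x))) (norm (u - x)) \<le> e"
      then have "x \<noteq> y" using c1 by auto
      obtain \<gamma> where "geodesic x y \<gamma>" using geodesic_ex K by blast
      then have "norm (direction x y) = 1" using direction(1) K \<open>x \<noteq> y\<close> by blast
      then have cos: "norm (u - x) * cos (vec_angle (- direction x y) (u - x)) = - (direction x y \<bullet> (u - x))"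
        using cos_vec_angle[of "- direction x y" "u - x"] by simp
      have "norm (u - x) powr (3 / 2) = norm (u - x) powr (1 / 2 + 1)" by simp
      also have "\<dots> = sqrt (norm (u - x)) * norm (u - x)" unfolding powr_add by (simp add: powr_half_sqrt)
      finally have pow: "norm (u - x) powr (3 / 2) = sqrt (norm (u - x)) * norm (u - x)" .
      show "\<bar>intr_dist D u y - (intr_dist D x y + norm (u - x) * cos (vec_angle (- init_dir D x y) (u - x)))\<bar>
            \<le> variation_const * norm (u - x) powr (3 / 2)"
        using var[OF K] a unfolding dir[OF K(1,2)] cos pow by (simp add: mult.assoc)
    qed
  next
    fix x y assume K: "x \<in> closure D" "y \<in> closure D" "x \<noteq> y"
    show "has_gradient_within (\<lambda>u. intr_dist D u y) (- init_dir D x y) x (closure D)"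
      unfolding has_gradient_within_def dir[OF K(1,2)] by (rule has_derivative_d_left[OF K])
  next
    fix x y assume K: "x \<in> closure D" "y \<in> closure D" "x \<noteq> y"
    show "has_gradient_within (\<lambda>(u, v). intr_dist D u v) (- init_dir D x y, - init_dir D y x) (x, y)
              (closure D \<times> closure D)"
      unfolding has_gradient_within_def dir[OF K(1,2)] dir[OF K(2,1)] by (rule has_derivative_d[OF K])
  qed
qed

end
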